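(* Let $g$ be a function defined by a non-deterministic register transducer with input alphabet $A$ and output alphabet $B$, and $f$ a function defined by a non-deterministic register transducer with input alphabet $B$ and output alphabet $C$. Then the composition $f\circ g:x\mapsto f(g(x))$ is effectively definable by a non-deterministic register transducer (with input alphabet $A$ and output alphabet $C$).
   Context: Let $\mathcal{D}$ be a countably infinite set of data values with a distinguished $d_0\in\mathcal{D}$. For finite alphabets $\Sigma$ (input) and $\Gamma$ (output), a test over a finite register set $R$ is a Boolean combination of $\top,\bot,r^{=},r^{\neq}$ ($r\in R$); for $\tau:R\to\mathcal{D}$ and $d\in\mathcal{D}$, $\tau,d\models r^{=}$ iff $\tau(r)=d$, $\tau,d\models r^{\neq}$ iff $\tau(r)\neq d$. A non-deterministic register transducer (NRT) is $T=(Q,R,i_0,F,\Delta)$ with finite states $Q$, initial $i_0$, accepting $F\subseteq Q$, finite register set $R$, and finite $\Delta\subseteq Q\times\Sigma\times\mathrm{Tests}_R\times2^R\times(\Gamma\times R)^*\times Q$. From configuration $(q,\tau)$, reading $(\sigma,d)$, a transition $(q,\sigma,\phi,\mathrm{asgn},o,q')$ with $\tau,d\models\phi$ leads to $(q',\tau')$ with $\tau'(r)=d$ if $r\in\mathrm{asgn}$ and $\tau'(r)=\tau(r)$ otherwise, outputting $(\gamma_1,\tau'(r_1))\cdots(\gamma_m,\tau'(r_m))$ where $o=(\gamma_1,r_1)\cdots(\gamma_m,r_m)$. An accepting run starts in $i_0$ with all registers equal to $d_0$ and visits $F$ infinitely often; standing assumption: accepting runs produce infinite outputs. $[\![T]\!]\subseteq(\Sigma\times\mathcal{D})^\omega\times(\Gamma\times\mathcal{D})^\omega$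 is the set of pairs (input, output) of accepting runs; a function $f$ is defined by $T$ if $[\![T]\!]$ is (the graph of) the partial function $f$. *)

theory Defs
  imports
    Main
    "HOL-Library.Countable_Set"
    "HOL-Library.Nat_Bijection"
begin

section \<open>Register transducers\<close>

text \<open>States and registers are named by natural numbers; letters and data values are arbitrary.\<close>

datatype test =
    Top
  | Bot
  | Equal nat
  | Unequal nat
  | Neg test
  | Conj test test
  | Disj test test

primrec test_regs :: "test \<Rightarrow> nat set" where
  "test_regs Top = {}"
| "test_regs Bot = {}"
| "test_regs (Equal r) = {r}"
| "test_regs (Unequal r) = {r}"
| "test_regs (Neg \<phi>) = test_regs \<phi>"
| "test_regs (Conj \<phi> \<psi>) = test_regs \<phi> \<union> test_regs \<psi>"
| "test_regs (Disj \<phi> \<psi>) = test_regs \<phi> \<union> test_regs \<psi>"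

primrec sat :: "(nat \<Rightarrow> 'd) \<Rightarrow> 'd \<Rightarrow> test \<Rightarrow> bool" where
  "sat \<tau> d Top \<longleftrightarrow> True"
| "sat \<tau> d Bot \<longleftrightarrow> False"
| "sat \<tau> d (Equal r) \<longleftrightarrow> \<tau> r = d"
| "sat \<tau> d (Unequal r) \<longleftrightarrow> \<tau> r \<noteq> d"
| "sat \<tau> d (Neg \<phi>) \<longleftrightarrow> \<not> sat \<tau> d \<phi>"
| "sat \<tau> d (Conj \<phi> \<psi>) \<longleftrightarrow> sat \<tau> d \<phi> \<and> sat \<tau> d \<psi>"
| "sat \<tau> d (Disj \<phi> \<psi>) \<longleftrightarrow> sat \<tau> d \<phi> \<or> sat \<tau> d \<psi>"

text \<open>A transition is a tuple (source, letter, test, assigned registers, output, target).\<close>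

type_synonym ('a, 'b) transition = "nat \<times> 'a \<times> test \<times> nat set \<times> ('b \<times> nat) list \<times> nat"

record ('a, 'b) nrt =
  states :: "nat set"
  regs :: "nat set"
  initial :: nat
  accepting :: "nat set"
  delta :: "('a, 'b) transition set"

definition wf_nrt :: "'a set \<Rightarrow> 'b set \<Rightarrow> ('a, 'b) nrt \<Rightarrow> bool" where
  "wf_nrt A B T \<longleftrightarrow>
     finite (states T) \<and> finite (regs T) \<and> finite (delta T) \<and>
     initial T \<in> states T \<and> accepting T \<subseteq> states T \<and>
     (\<forall>(q, a, \<phi>, asgn, out, q') \<in> delta T.
        q \<in> states T \<and> a \<in> A \<and> test_regs \<phi> \<subseteq> regs T \<and> asgn \<subseteq> regs T \<and>
        set out \<subseteq> B \<times> regs T \<and> q' \<in> states T)"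

text \<open>
  In a configuration the valuation is a total function on the naturals; its values outside
  the registers of the transducer are never inspected.  Outputs are read off from the
  valuation after the assignment.
\<close>

inductive step ::
    "('a, 'b) nrt \<Rightarrow> nat \<times> (nat \<Rightarrow> 'd) \<Rightarrow> 'a \<times> 'd \<Rightarrow> ('b \<times> 'd) list \<Rightarrow>
     nat \<times> (nat \<Rightarrow> 'd) \<Rightarrow> bool"
  for T where
  "\<lbrakk>(q, a, \<phi>, asgn, out, q') \<in> delta T; sat \<tau> d \<phi>;
    \<tau>' = (\<lambda>r. if r \<in> asgn then d else \<tau> r)\<rbrakk>
   \<Longrightarrow> step T (q, \<tau>) (a, d) (map (\<lambda>(b, r). (b, \<tau>' r)) out) (q', \<tau>')"

type_synonym 'x omega_word = "nat \<Rightarrow> 'x"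

definition accepting_run ::
    "'d \<Rightarrow> ('a, 'b) nrt \<Rightarrow> ('a \<times> 'd) omega_word \<Rightarrow> (nat \<Rightarrow> nat \<times> (nat \<Rightarrow> 'd)) \<Rightarrow>
     (nat \<Rightarrow> ('b \<times> 'd) list) \<Rightarrow> bool" where
  "accepting_run d0 T x c out \<longleftrightarrow>
     c 0 = (initial T, \<lambda>_. d0) \<and>
     (\<forall>n. step T (c n) (x n) (out n) (c (Suc n))) \<and>
     infinite {n. fst (c n) \<in> accepting T}"

definition output_upto :: "(nat \<Rightarrow> 'x list) \<Rightarrow> nat \<Rightarrow> 'x list" where
  "output_upto out n = concat (map out [0..<n])"

definition infinite_output :: "(nat \<Rightarrow> 'x list) \<Rightarrow> bool" where
  "infinite_output out \<longleftrightarrow> (\<forall>k. \<exists>n. k \<le> length (output_upto out n))"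

text \<open>The infinite concatenation of the blocks \<open>out 0\<close>, \<open>out 1\<close>, \dots is the word \<open>y\<close>.\<close>

definition spells :: "(nat \<Rightarrow> 'x list) \<Rightarrow> 'x omega_word \<Rightarrow> bool" where
  "spells out y \<longleftrightarrow>
     infinite_output out \<and>
     (\<forall>n. output_upto out n = map y [0..<length (output_upto out n)])"

definition productive :: "'d \<Rightarrow> ('a, 'b) nrt \<Rightarrow> bool" where
  "productive d0 T \<longleftrightarrow> (\<forall>x c out. accepting_run d0 T x c out \<longrightarrow> infinite_output out)"

definition semantics ::
    "'d \<Rightarrow> ('a, 'b) nrt \<Rightarrow> (('a \<times> 'd) omega_word \<times> ('b \<times> 'd) omega_word) set" where
  "semantics d0 T = {(x, y). \<exists>c out. accepting_run d0 T x c out \<and> spells out y}"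

definition realizes ::
    "'d \<Rightarrow> 'a set \<Rightarrow> 'b set \<Rightarrow> ('a, 'b) nrt \<Rightarrow>
     (('a \<times> 'd) omega_word \<rightharpoonup> ('b \<times> 'd) omega_word) \<Rightarrow> bool" where
  "realizes d0 A B T f \<longleftrightarrow>
     wf_nrt A B T \<and> productive d0 T \<and> semantics d0 T = {(x, y). f x = Some y}"


section \<open>Computable functions\<close>

text \<open>
  Unary partial recursive functions over the naturals, with the standard pairing in place of
  several arguments.
\<close>

inductive partrec :: "(nat \<rightharpoonup> nat) \<Rightarrow> bool" where
  zero: "partrec (\<lambda>_. Some 0)"
| succ: "partrec (\<lambda>n. Some (Suc n))"
| left: "partrec (\<lambda>n. Some (fst (prod_decode n)))"
| right: "partrec (\<lambda>n. Some (snd (prod_decode n)))"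
| pair: "\<lbrakk>partrec f; partrec g\<rbrakk> \<Longrightarrow>
    partrec (\<lambda>n. Option.bind (f n) (\<lambda>a. Option.bind (g n) (\<lambda>b. Some (prod_encode (a, b)))))"
| comp: "\<lbrakk>partrec f; partrec g\<rbrakk> \<Longrightarrow> partrec (\<lambda>n. Option.bind (g n) f)"
| prec: "\<lbrakk>partrec f; partrec g\<rbrakk> \<Longrightarrow>
    partrec (\<lambda>n. case prod_decode n of (a, k) \<Rightarrow>
      rec_nat (f a)
        (\<lambda>m r. Option.bind r (\<lambda>v. g (prod_encode (a, prod_encode (m, v))))) k)"
| mu: "partrec f \<Longrightarrow>
    partrec (\<lambda>a.
      if \<exists>n. f (prod_encode (a, n)) = Some 0 \<and> (\<forall>m<n. f (prod_encode (a, m)) \<noteq> None)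
      then Some (LEAST n. f (prod_encode (a, n)) = Some 0)
      else None)"

definition computable :: "(nat \<Rightarrow> nat) \<Rightarrow> bool" where
  "computable h \<longleftrightarrow> partrec (\<lambda>n. Some (h n))"


section \<open>Coding of transducers\<close>

primrec encode_test :: "test \<Rightarrow> nat" where
  "encode_test Top = prod_encode (0, 0)"
| "encode_test Bot = prod_encode (1, 0)"
| "encode_test (Equal r) = prod_encode (2, r)"
| "encode_test (Unequal r) = prod_encode (3, r)"
| "encode_test (Neg \<phi>) = prod_encode (4, encode_test \<phi>)"
| "encode_test (Conj \<phi> \<psi>) = prod_encode (5, prod_encode (encode_test \<phi>, encode_test \<psi>))"
| "encode_test (Disj \<phi> \<psi>) = prod_encode (6, prod_encode (encode_test \<phi>, encode_test \<psi>))"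

text \<open>
  The parameters \<open>ea\<close> and \<open>eb\<close> number the letters of the input and the output alphabet; they are
  meant to be injective there.  For well-formed transducers all sets passed to
  \<^const>\<open>set_encode\<close> are finite, so no information is lost.
\<close>

fun encode_transition :: "('a \<Rightarrow> nat) \<Rightarrow> ('b \<Rightarrow> nat) \<Rightarrow> ('a, 'b) transition \<Rightarrow> nat" where
  "encode_transition ea eb (q, a, \<phi>, asgn, out, q') =
     list_encode
       [q, ea a, encode_test \<phi>, set_encode asgn,
        list_encode (map (\<lambda>(b, r). prod_encode (eb b, r)) out), q']"

definition encode_nrt :: "('a \<Rightarrow> nat) \<Rightarrow> ('b \<Rightarrow> nat) \<Rightarrow> ('a, 'b) nrt \<Rightarrow> nat" where
  "encode_nrt ea eb T =
     list_encode
       [set_encode (states T), set_encode (regs T), initial T, set_encode (accepting T),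
        set_encode (encode_transition ea eb ` delta T)]"

end

(*
  The composite transducer runs the first machine, feeds each block it writes to the second machine
  at once, and checks both acceptance conditions with a one-bit degeneralisation.  Registers cannot
  be copied into one another, so the composite keeps in its finite control a map from the registers
  of both machines to its own registers (locations), maintaining that distinct locations in use hold
  distinct data.  On reading a datum it guesses its location: one in use that already contains it, or
  a free one; the guess is verified by a test and the datum is stored there.  Under the invariant a
  test of either machine holds for the data iff it holds for the locations, so both machines are run
  symbolically with locations in place of data, and the symbolic output is literally the output word
  of a transition of the composite.

  For effectivity, functions between types with a numerical coding are shown to be computable on
  codes, closing under primitive recursion and the usual list operations; the construction is then
  written as a list program on the codes of the two machines.
*)
theory Submission
  imports Defs "HOL-Library.More_List"
begin

section \<open>Effective functions on coded types\<close>

text \<open>The composite consumes one letter while the second machine makes any number of moves,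
  possibly none, so neither the states nor the acceptance of the second machine line up with those
  of the composite. Its run is therefore treated as one infinite word of edges, each carrying
  source, letter, output and target; the output blocks of the first machine cut this word.
  Projections of the word give input, output and visited states, and regrouping carries output and
  recurrence across the cut. Productivity of the first machine makes the edge word infinite, that of
  the second makes the final output infinite. Data abstraction is kept apart from this: the
  composite is matched with joint moves of the two concrete machines, and only joint runs are
  related to pairs of runs. The code function has to be the same for all letter types and
  numberings, so it treats letters as mere numbers; it compares them just where the second machine
  reads what the first has written, and there \<open>eb\<close> is injective. Location maps are
  lists of a fixed length, which makes the states both finite in number and codable.\<close>

lemma computable_const: "computable (\<lambda>_. c)"
proof (induction c)
  case 0
  show ?case using partrec.zero by (simp add: computable_def)
next
  case (Suc c)
  then show ?case
    using partrec.comp[OF partrec.succ, of "\<lambda>_. Some c"] by (simp add: computable_def)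
qed

lemma computable_Suc: "computable Suc"
  using partrec.succ by (simp add: computable_def)

lemma computable_left: "computable (\<lambda>n. fst (prod_decode n))"
  using partrec.left by (simp add: computable_def)

lemma computable_right: "computable (\<lambda>n. snd (prod_decode n))"
  using partrec.right by (simp add: computable_def)

lemma computable_comp: "computable f \<Longrightarrow> computable g \<Longrightarrow> computable (\<lambda>n. f (g n))"
  using partrec.comp[of "\<lambda>n. Some (f n)" "\<lambda>n. Some (g n)"] by (simp add: computable_def)

lemma computable_pair:
  "computable f \<Longrightarrow> computable g \<Longrightarrow> computable (\<lambda>n. prod_encode (f n, g n))"
  using partrec.pair[of "\<lambda>n. Some (f n)" "\<lambda>n. Some (g n)"] by (simp add: computable_def)

lemma computable_id: "computable (\<lambda>n. n)"
  using computable_pair[OF computable_left computable_right] by simp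

text \<open>On total functions the partial scheme \<open>prec\<close> never meets an undefined
  intermediate value. Composing it with the pair of \<open>n\<close> and \<open>k n\<close> lets the
  number of rounds depend on the parameter.\<close>

lemma computable_rec_nat:
  assumes f: "computable f" and g: "computable g" and k: "computable k"
  shows "computable (\<lambda>n. rec_nat (f n) (\<lambda>m v. g (prod_encode (n, prod_encode (m, v)))) (k n))"
proof -
  have "rec_nat (Some (f a))
          (\<lambda>m r. Option.bind r (\<lambda>v. Some (g (prod_encode (a, prod_encode (m, v)))))) j =
        Some (rec_nat (f a) (\<lambda>m v. g (prod_encode (a, prod_encode (m, v)))) j)" for a j
    by (induction j) simp_all
  with partrec.prec[of "\<lambda>n. Some (f n)" "\<lambda>n. Some (g n)"] f g
  have "computable (\<lambda>n. case prod_decode n of (a, j) \<Rightarrow>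
      rec_nat (f a) (\<lambda>m v. g (prod_encode (a, prod_encode (m, v)))) j)"
    by (simp add: computable_def case_prod_beta)
  from computable_comp[OF this computable_pair[OF computable_id k]] show ?thesis by simp
qed

section \<open>Types with an injective numbering, and functions computable on codes\<close>

class enc =
  fixes enc :: "'a \<Rightarrow> nat"
  assumes enc_eq_iff [simp]: "enc x = enc y \<longleftrightarrow> x = y"

instantiation nat :: enc
begin
definition enc_nat :: "nat \<Rightarrow> nat" where [simp]: "enc_nat n = n"
instance by standard simp
end

instantiation bool :: enc
begin
definition enc_bool :: "bool \<Rightarrow> nat" where "enc_bool b = (if b then 1 else 0)"
instance by standard (simp add: enc_bool_def)
end

instantiation prod :: (enc, enc) enc
begin
definition enc_prod :: "'a \<times> 'b \<Rightarrow> nat" where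
  "enc_prod p = prod_encode (enc (fst p), enc (snd p))"
instance by standard (auto simp: enc_prod_def prod_eq_iff)
end

instantiation list :: (enc) enc
begin
text \<open>Built from \<open>list_encode\<close>, as the coding of transducers is, so that those
  codes are literally values of \<open>enc\<close> on lists of naturals.\<close>

definition enc_list :: "'a list \<Rightarrow> nat" where "enc_list l = list_encode (map enc l)"
instance
proof
  fix x y :: "'a list"
  have "inj (map (enc :: 'a \<Rightarrow> nat))"
    by (rule inj_mapI) (simp add: inj_on_def)
  then show "enc x = enc y \<longleftrightarrow> x = y"
    by (simp add: enc_list_def list_encode_eq inj_eq del: inj_map)
qed
end

lemma enc_Pair: "enc (a, b) = prod_encode (enc a, enc b)"
  by (simp add: enc_prod_def)

lemma enc_Nil: "enc ([] :: 'a::enc list) = 0"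
  by (simp add: enc_list_def)

lemma enc_Cons: "enc (x # xs) = Suc (enc (x, xs))"
  by (simp add: enc_list_def enc_prod_def)

text \<open>The numbering need not be onto: nothing is asked of \<open>h\<close> at numbers that are
  not codes.\<close>

definition effective :: "('a::enc \<Rightarrow> 'b::enc) \<Rightarrow> bool" where
  "effective f \<longleftrightarrow> (\<exists>h. computable h \<and> (\<forall>x. h (enc x) = enc (f x)))"

named_theorems eff

lemma effectiveI: "computable h \<Longrightarrow> (\<And>x. h (enc x) = enc (f x)) \<Longrightarrow> effective f"
  unfolding effective_def by blast

lemma effective_const [eff]: "effective (\<lambda>_. c)"
  by (rule effectiveI[OF computable_const[of "enc c"]]) simp

lemma effective_id [eff]: "effective (\<lambda>x. x)"
  by (rule effectiveI[OF computable_id]) simp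

lemma effective_comp:
  assumes "effective f" "effective g" shows "effective (\<lambda>x. f (g x))"
proof -
  obtain h where h: "computable h \<and> (\<forall>x. h (enc x) = enc (f x))"
    using assms(1) unfolding effective_def ..
  obtain k where k: "computable k \<and> (\<forall>x. k (enc x) = enc (g x))"
    using assms(2) unfolding effective_def ..
  show ?thesis
    by (rule effectiveI[of "\<lambda>n. h (k n)"]) (simp_all add: h k computable_comp)
qed

text \<open>A code, seen as a natural number, is its own code. Values of any coded type can thus be
  inspected by arithmetic inside an effective term.\<close>

lemma effective_enc [eff]: "effective f \<Longrightarrow> effective (\<lambda>x. enc (f x))"
  unfolding effective_def by simp

lemma effective_Pair [eff]:
  assumes "effective f" "effective g" shows "effective (\<lambda>x. (f x, g x))"
proof -
  obtain h where h: "computable h \<and> (\<forall>x. h (enc x) = enc (f x))"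
    using assms(1) unfolding effective_def ..
  obtain k where k: "computable k \<and> (\<forall>x. k (enc x) = enc (g x))"
    using assms(2) unfolding effective_def ..
  show ?thesis
    by (rule effectiveI[of "\<lambda>n. prod_encode (h n, k n)"])
      (simp_all add: h k computable_pair enc_prod_def)
qed

text \<open>Functions of several bound variables are assumed effective on tuples, written with
  projections; this rule and the next plug effective terms into such an assumption, so that
  \<open>intro eff\<close> can proceed under binders.\<close>

lemma effective_comp2:
  assumes "effective (\<lambda>z. f (fst z) (snd z))" "effective u" "effective v"
  shows "effective (\<lambda>x. f (u x) (v x))"
  using effective_comp[OF assms(1) effective_Pair[OF assms(2,3)]] by simp

lemma effective_comp3:
  assumes "effective (\<lambda>z. f (fst z) (fst (snd z)) (snd (snd z)))"
    "effective u" "effective v" "effective w"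
  shows "effective (\<lambda>x. f (u x) (v x) (w x))"
  using effective_comp[OF assms(1) effective_Pair[OF assms(2) effective_Pair[OF assms(3,4)]]] by simp

lemma effective_fst [eff]: "effective f \<Longrightarrow> effective (\<lambda>x. fst (f x))"
  by (rule effective_comp[of fst], rule effectiveI[OF computable_left]) (simp_all add: enc_prod_def)

lemma effective_snd [eff]: "effective f \<Longrightarrow> effective (\<lambda>x. snd (f x))"
  by (rule effective_comp[of snd], rule effectiveI[OF computable_right]) (simp_all add: enc_prod_def)

lemma effective_Suc [eff]: "effective f \<Longrightarrow> effective (\<lambda>x. Suc (f x))"
  by (rule effective_comp[of Suc], rule effectiveI[OF computable_Suc]) simp_all

lemma effective_rec_nat [eff]:
  assumes "effective f" "effective (\<lambda>z. g (fst z) (fst (snd z)) (snd (snd z)))" "effective k"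
  shows "effective (\<lambda>x. rec_nat (f x) (\<lambda>m v. g x m v) (k x))"
proof -
  obtain hf where hf: "computable hf \<and> (\<forall>x. hf (enc x) = enc (f x))"
    using assms(1) unfolding effective_def ..
  obtain hg where hg: "computable hg \<and> (\<forall>z. hg (enc z) = enc (g (fst z) (fst (snd z)) (snd (snd z))))"
    using assms(2) unfolding effective_def ..
  obtain hk where hk: "computable hk \<and> (\<forall>x. hk (enc x) = enc (k x))"
    using assms(3) unfolding effective_def ..
  have step: "hg (prod_encode (enc x, prod_encode (m, enc v))) = enc (g x m v)" for x m v
    using conjunct2[OF hg, rule_format, of "(x, m, v)"] by (simp add: enc_prod_def)
  have "rec_nat (enc (f x)) (\<lambda>m v. hg (prod_encode (enc x, prod_encode (m, v)))) j =
      enc (rec_nat (f x) (\<lambda>m v. g x m v) j)" for x j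
    by (induction j) (simp_all add: step)
  then show ?thesis
    by (intro effectiveI[OF computable_rec_nat[OF conjunct1[OF hf] conjunct1[OF hg] conjunct1[OF hk]]])
      (simp add: hf hk)
qed

lemma effective_funpow [eff]:
  fixes g :: "'a::enc \<Rightarrow> 'b::enc \<Rightarrow> 'b"
  assumes "effective (\<lambda>z. g (fst z) (snd z))" "effective f" "effective k"
  shows "effective (\<lambda>x. (g x ^^ k x) (f x))"
proof -
  have eq: "(g x ^^ j) a = rec_nat a (\<lambda>_. g x) j" for x j a
    by (induction j) simp_all
  show ?thesis unfolding eq using assms(2,3) by (intro eff effective_comp2[OF assms(1)])
qed

lemma effective_case_nat [eff]:
  assumes "effective f" "effective (\<lambda>z. g (fst z) (snd z))" "effective k"
  shows "effective (\<lambda>x. case k x of 0 \<Rightarrow> f x | Suc m \<Rightarrow> g x m)"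
proof -
  have eq: "(case j of 0 \<Rightarrow> a | Suc m \<Rightarrow> h m) = rec_nat a (\<lambda>m _. h m) j" for h and j and a :: 'z
    by (cases j) simp_all
  show ?thesis unfolding eq using assms(1,3) by (intro eff effective_comp2[OF assms(2)])
qed

lemma effective_if [eff]:
  assumes "effective b" "effective f" "effective g"
  shows "effective (\<lambda>x. if b x then f x else g x)"
proof -
  have "effective (\<lambda>x. case enc (b x) of 0 \<Rightarrow> g x | Suc m \<Rightarrow> f x)"
    using assms(1,3) by (intro eff effective_comp[OF assms(2)])
  also have "(\<lambda>x. case enc (b x) of 0 \<Rightarrow> g x | Suc m \<Rightarrow> f x) = (\<lambda>x. if b x then f x else g x)"
    by (auto simp: enc_bool_def)
  finally show ?thesis .
qed

lemma effective_Not [eff]: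
  "effective b \<Longrightarrow> effective (\<lambda>x. \<not> b x)"
proof -
  have eq: "(\<not> p) = (if p then False else True)" for p by simp
  show "effective b \<Longrightarrow> effective (\<lambda>x. \<not> b x)" unfolding eq by (intro eff)
qed

lemma effective_conj [eff]:
  "effective a \<Longrightarrow> effective b \<Longrightarrow> effective (\<lambda>x. a x \<and> b x)"
proof -
  have eq: "(p \<and> q) = (if p then q else False)" for p q by simp
  show "effective a \<Longrightarrow> effective b \<Longrightarrow> effective (\<lambda>x. a x \<and> b x)" unfolding eq by (intro eff)
qed

lemma effective_disj [eff]:
  "effective a \<Longrightarrow> effective b \<Longrightarrow> effective (\<lambda>x. a x \<or> b x)"
proof -
  have eq: "(p \<or> q) = (if p then True else q)" for p q by simp
  show "effective a \<Longrightarrow> effective b \<Longrightarrow> effective (\<lambda>x. a x \<or> b x)" unfolding eq by (intro eff)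
qed

section \<open>Arithmetic, equality, and membership in coded finite sets\<close>

lemma effective_add [eff]: "effective f \<Longrightarrow> effective g \<Longrightarrow> effective (\<lambda>x. f x + g x :: nat)"
proof -
  have eq: "a + b = (Suc ^^ b) a" for a b :: nat
    by (induction b) simp_all
  show "effective f \<Longrightarrow> effective g \<Longrightarrow> effective (\<lambda>x. f x + g x :: nat)"
    unfolding eq by (intro eff)
qed

lemma effective_diff [eff]: "effective f \<Longrightarrow> effective g \<Longrightarrow> effective (\<lambda>x. f x - g x :: nat)"
proof -
  have eq: "a - b = ((\<lambda>v. case v of 0 \<Rightarrow> 0 | Suc m \<Rightarrow> m) ^^ b) a" for a b :: nat
    by (induction b) (simp_all add: diff_Suc)
  show "effective f \<Longrightarrow> effective g \<Longrightarrow> effective (\<lambda>x. f x - g x :: nat)"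
    unfolding eq by (intro eff)
qed

text \<open>Injectivity of \<open>enc\<close> reduces equality to numbers, where it means that both
  truncated differences vanish.\<close>

lemma effective_eq [eff]:
  assumes "effective f" "effective g" shows "effective (\<lambda>x. f x = g x)"
proof -
  have eq: "f x = g x \<longleftrightarrow>
      (case (enc (f x) - enc (g x)) + (enc (g x) - enc (f x)) of 0 \<Rightarrow> True | Suc m \<Rightarrow> False)" for x
  proof -
    have "f x = g x \<longleftrightarrow> enc (f x) = enc (g x)" by simp
    also have "\<dots> \<longleftrightarrow> (case (enc (f x) - enc (g x)) + (enc (g x) - enc (f x)) of 0 \<Rightarrow> True | Suc m \<Rightarrow> False)"
      by (auto split: nat.split)
    finally show ?thesis .
  qed
  show ?thesis unfolding eq using assms by (intro eff)
qed

lemma effective_odd [eff]: "effective f \<Longrightarrow> effective (\<lambda>x. odd (f x :: nat))"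
proof -
  have eq: "odd n \<longleftrightarrow> (Not ^^ n) False" for n :: nat
    by (induction n) simp_all
  show "effective f \<Longrightarrow> effective (\<lambda>x. odd (f x :: nat))"
    unfolding eq by (intro eff)
qed

lemma effective_div2 [eff]: "effective f \<Longrightarrow> effective (\<lambda>x. f x div 2 :: nat)"
proof -
  have eq: "n div 2 = rec_nat 0 (\<lambda>m v. if odd m then Suc v else v) n" for n :: nat
  proof (induction n)
    case (Suc n)
    have "Suc n div 2 = (if odd n then Suc (n div 2) else n div 2)" by auto
    with Suc show ?case by simp
  qed simp
  show "effective f \<Longrightarrow> effective (\<lambda>x. f x div 2 :: nat)"
    unfolding eq by (intro eff)
qed

lemma effective_power2 [eff]: "effective f \<Longrightarrow> effective (\<lambda>x. 2 ^ f x :: nat)"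
proof -
  have eq: "2 ^ n = ((\<lambda>v. v + v) ^^ n) (1 :: nat)" for n
    by (induction n) simp_all
  show "effective f \<Longrightarrow> effective (\<lambda>x. 2 ^ f x :: nat)"
    unfolding eq by (intro eff)
qed

lemma effective_mem_set_decode [eff]:
  "effective f \<Longrightarrow> effective g \<Longrightarrow> effective (\<lambda>x. f x \<in> set_decode (g x))"
proof -
  have eq: "n \<in> set_decode s \<longleftrightarrow> odd (((\<lambda>v. v div 2) ^^ n) s)" for n s :: nat
    by (induction n arbitrary: s) (simp_all add: funpow_Suc_right del: funpow.simps(2))
  show "effective f \<Longrightarrow> effective g \<Longrightarrow> effective (\<lambda>x. f x \<in> set_decode (g x))"
    unfolding eq by (intro eff)
qed

section \<open>List operations\<close>

lemma effective_Cons [eff]: "effective f \<Longrightarrow> effective g \<Longrightarrow> effective (\<lambda>x. f x # g x)"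
proof -
  assume "effective f" "effective g"
  then have "effective (\<lambda>x. Suc (enc (f x, g x)))" by (intro eff)
  then show ?thesis unfolding effective_def by (simp add: enc_Cons)
qed

lemma effective_case_list [eff]:
  assumes "effective f" "effective (\<lambda>z. g (fst z) (fst (snd z)) (snd (snd z)))" "effective l"
  shows "effective (\<lambda>x. case l x of [] \<Rightarrow> f x | y # ys \<Rightarrow> g x y ys)"
proof -
  obtain hf where hf: "computable hf \<and> (\<forall>x. hf (enc x) = enc (f x))"
    using assms(1) unfolding effective_def ..
  obtain hg where hg: "computable hg \<and> (\<forall>z. hg (enc z) = enc (g (fst z) (fst (snd z)) (snd (snd z))))"
    using assms(2) unfolding effective_def ..
  obtain hl where hl: "computable hl \<and> (\<forall>x. hl (enc x) = enc (l x))"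
    using assms(3) unfolding effective_def ..
  have step: "hg (prod_encode (enc x, enc (y, ys))) = enc (g x y ys)" for x y ys
    using conjunct2[OF hg, rule_format, of "(x, y, ys)"] by (simp add: enc_prod_def)
  \<comment> \<open>A nonempty list has the code \<open>Suc m\<close> with \<open>m\<close> the code
    of the pair of head and tail. At that number the recursor supplies the parameter,
    \<open>m\<close> and the previous value; only the first two are kept.\<close>
  have "computable (\<lambda>n. hg (prod_encode (fst (prod_decode n), fst (prod_decode (snd (prod_decode n))))))"
    by (intro computable_comp[OF conjunct1[OF hg]] computable_pair computable_left
        computable_comp[OF computable_left computable_right])
  from computable_rec_nat[OF conjunct1[OF hf] this conjunct1[OF hl]] show ?thesis
    by (rule effectiveI) (simp add: hf hl step enc_Nil enc_Cons split: list.split)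
qed

text \<open>Provides a computable number of rounds for recursion along a list: as many rounds as its
  code surely exhaust it.\<close>

lemma length_le_enc: "length l \<le> enc l"
proof (induction l)
  case (Cons x l)
  have "enc l \<le> enc (x, l)" unfolding enc_Pair by (rule le_prod_encode_2)
  with Cons show ?case by (simp add: enc_Cons)
qed simp

text \<open>Iterates a step that absorbs the head of the remaining list into the accumulator. On an
  empty remainder the step idles, so the generous count from \<open>length_le_enc\<close> does no
  harm.\<close>

lemma effective_foldl [eff]:
  assumes "effective (\<lambda>z. g (fst z) (fst (snd z)) (snd (snd z)))" "effective f" "effective l"
  shows "effective (\<lambda>x. foldl (g x) (f x) (l x))"
proof -
  define G where "G x p = (case snd p of [] \<Rightarrow> (fst p, []) | y # ys \<Rightarrow> (g x (fst p) y, ys))" for x p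
  have "length ys \<le> n \<Longrightarrow> (G x ^^ n) (a, ys) = (foldl (g x) a ys, [])" for x n a ys
  proof (induction n arbitrary: a ys)
    case (Suc n)
    then show ?case by (cases ys) (simp_all add: funpow_Suc_right G_def del: funpow.simps(2))
  qed simp
  then have eq: "foldl (g x) (f x) (l x) = fst ((G x ^^ enc (l x)) (f x, l x))" for x
    by (simp add: length_le_enc)
  show ?thesis unfolding eq G_def using assms(2,3) by (intro eff effective_comp3[OF assms(1)])
qed

lemma effective_rev [eff]: "effective l \<Longrightarrow> effective (\<lambda>x. rev (l x))"
proof -
  have eq: "rev l = foldl (\<lambda>acc y. y # acc) [] l" for l :: "'c list"
    by (simp add: foldl_conv_fold rev_conv_fold)
  show "effective l \<Longrightarrow> effective (\<lambda>x. rev (l x))" unfolding eq by (intro eff)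
qed

lemma effective_foldr [eff]:
  assumes "effective (\<lambda>z. g (fst z) (fst (snd z)) (snd (snd z)))" "effective f" "effective l"
  shows "effective (\<lambda>x. foldr (g x) (l x) (f x))"
proof -
  show ?thesis unfolding foldr_conv_foldl using assms(2,3)
    by (intro eff effective_comp3[OF assms(1)])
qed

lemma effective_append [eff]: "effective f \<Longrightarrow> effective g \<Longrightarrow> effective (\<lambda>x. f x @ g x)"
proof -
  have eq: "xs @ ys = foldr (\<lambda>y a. y # a) xs ys" for xs ys :: "'c list"
    by (induction xs) simp_all
  show "effective f \<Longrightarrow> effective g \<Longrightarrow> effective (\<lambda>x. f x @ g x)" unfolding eq by (intro eff)
qed

lemma effective_concat [eff]: "effective l \<Longrightarrow> effective (\<lambda>x. concat (l x))"
proof -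
  have eq: "concat l = foldr (\<lambda>y a. y @ a) l []" for l :: "'c list list"
    by (induction l) simp_all
  show "effective l \<Longrightarrow> effective (\<lambda>x. concat (l x))" unfolding eq by (intro eff)
qed

lemma effective_map [eff]:
  assumes "effective (\<lambda>z. g (fst z) (snd z))" "effective l"
  shows "effective (\<lambda>x. map (g x) (l x))"
proof -
  have eq: "map h ys = foldr (\<lambda>y a. h y # a) ys []" for h :: "'b \<Rightarrow> 'c" and ys
    by (induction ys) simp_all
  show ?thesis unfolding eq using assms(2) by (intro eff effective_comp2[OF assms(1)])
qed

lemma effective_filter [eff]:
  assumes "effective (\<lambda>z. g (fst z) (snd z))" "effective l"
  shows "effective (\<lambda>x. filter (g x) (l x))"
proof -
  have eq: "filter h ys = foldr (\<lambda>y a. if h y then y # a else a) ys []" for h :: "'b \<Rightarrow> bool" and ys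
    by (induction ys) simp_all
  show ?thesis unfolding eq using assms(2) by (intro eff effective_comp2[OF assms(1)])
qed

lemma effective_mem_set [eff]:
  "effective f \<Longrightarrow> effective l \<Longrightarrow> effective (\<lambda>x. f x \<in> set (l x))"
proof -
  have eq: "a \<in> set l \<longleftrightarrow> foldr (\<lambda>y b. a = y \<or> b) l False" for a :: 'b and l
    by (induction l) simp_all
  assume f: "effective f" and "effective l"
  then show ?thesis
    unfolding eq by (intro eff effective_comp[OF f])
qed

lemma effective_upt [eff]: "effective k \<Longrightarrow> effective (\<lambda>x. [0..<k x])"
proof -
  have eq: "[0..<n] = rec_nat [] (\<lambda>m v. v @ [m]) n" for n
    by (induction n) simp_all
  show "effective k \<Longrightarrow> effective (\<lambda>x. [0..<k x])" unfolding eq by (intro eff)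
qed

lemma effective_n_lists [eff]:
  assumes "effective k" "effective l"
  shows "effective (\<lambda>x. List.n_lists (k x) (l x))"
proof -
  have eq: "List.n_lists n xs =
      ((\<lambda>L. concat (map (\<lambda>ys. map (\<lambda>y. y # ys) xs) L)) ^^ n) [[]]" for n and xs :: "'b list"
    by (induction n) simp_all
  show ?thesis
    unfolding eq using assms(1) by (intro eff effective_comp[OF assms(2)])
qed

lemma effective_replicate [eff]:
  assumes "effective k" "effective f" shows "effective (\<lambda>x. replicate (k x) (f x))"
proof -
  have eq: "replicate n y = (Cons y ^^ n) []" for n and y :: 'b
    by (induction n) simp_all
  show ?thesis unfolding eq using assms(1) by (intro eff effective_comp[OF assms(2)])
qed

lemma effective_nth_default [eff]:
  assumes "effective d" "effective l" "effective i"
  shows "effective (\<lambda>x. nth_default (d x) (l x) (i x))"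
proof -
  have eq: "nth_default e xs n =
      (case ((\<lambda>ys. case ys of [] \<Rightarrow> [] | _ # zs \<Rightarrow> zs) ^^ n) xs of [] \<Rightarrow> e | y # _ \<Rightarrow> y)"
    for e :: 'b and xs n
  proof (induction n arbitrary: xs)
    case 0
    then show ?case by (cases xs) simp_all
  next
    case (Suc n)
    have "nth_default e xs (Suc n) = nth_default e (tl xs) n"
      by (cases xs) simp_all
    also have "\<dots> = nth_default e (case xs of [] \<Rightarrow> [] | _ # zs \<Rightarrow> zs) n"
      by (cases xs) simp_all
    finally show ?case by (simp add: Suc funpow_Suc_right del: funpow.simps(2))
  qed
  show ?thesis unfolding eq using assms(2,3) by (intro eff effective_comp[OF assms(1)])
qed

section \<open>Regrouping infinite concatenations\<close>

lemma output_upto_Suc: "output_upto u (Suc n) = output_upto u n @ u n"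
  by (simp add: output_upto_def)

lemma output_upto_map: "output_upto (\<lambda>n. map f (u n)) n = map f (output_upto u n)"
  by (induction n) (simp_all add: output_upto_Suc output_upto_def[of _ 0])

lemma output_upto_concat:
  "output_upto (\<lambda>n. concat (map f (u n))) n = concat (map f (output_upto u n))"
  by (induction n) (simp_all add: output_upto_Suc output_upto_def[of _ 0])

lemma output_upto_prefix:
  assumes "m \<le> n" shows "\<exists>s. output_upto u n = output_upto u m @ s"
  using assms by (induction n rule: dec_induct) (auto simp: output_upto_Suc)

lemma length_output_upto_mono: "m \<le> n \<Longrightarrow> length (output_upto u m) \<le> length (output_upto u n)"
  using output_upto_prefix[of m n u] by auto

lemma infinite_output_map: "infinite_output (\<lambda>n. map f (u n)) \<longleftrightarrow> infinite_output u"
  by (simp add: infinite_output_def output_upto_map)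

lemma spells_exists:
  assumes "infinite_output u" shows "\<exists>y. spells u y"
proof -
  \<comment> \<open>The first prefix that contains position \<open>m\<close>; since prefixes only
    grow by appending, any later one gives the same letter.\<close>
  define N where "N m = (LEAST n. Suc m \<le> length (output_upto u n))" for m
  define y where "y m = output_upto u (N m) ! m" for m
  have N: "m < length (output_upto u (N m))" for m
  proof -
    have "\<exists>n. Suc m \<le> length (output_upto u n)"
      using assms unfolding infinite_output_def by blast
    then show ?thesis unfolding N_def Suc_le_eq[symmetric] by (rule LeastI_ex)
  qed
  have "output_upto u n ! m = y m" if "m < length (output_upto u n)" for n m
  proof -
    consider "n \<le> N m" | "N m \<le> n" by linarith
    then show ?thesis
    proof cases
      case 1
      from output_upto_prefix[OF this, of u] that show ?thesis by (auto simp: y_def nth_append)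
    next
      case 2
      from output_upto_prefix[OF this, of u] N[of m] show ?thesis by (auto simp: y_def nth_append)
    qed
  qed
  then have "output_upto u n = map y [0..<length (output_upto u n)]" for n
    by (intro nth_equalityI) simp_all
  with assms show ?thesis unfolding spells_def by blast
qed

lemma spells_map: "spells u y \<Longrightarrow> spells (\<lambda>n. map f (u n)) (\<lambda>m. f (y m))"
  unfolding spells_def infinite_output_map output_upto_map
  by (metis (no_types, lifting) length_map list.map_comp comp_apply map_eq_conv)

lemma spells_block:
  assumes "spells u y"
  shows "u n = map y [length (output_upto u n)..<length (output_upto u (Suc n))]"
proof -
  define k where "k = length (output_upto u n)"
  have "output_upto u n @ u n = map y [0..<k + length (u n)]"
    using assms unfolding spells_def k_def by (metis length_append output_upto_Suc)
  also have "\<dots> = map y [0..<k] @ map y [k..<k + length (u n)]"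
    by (simp flip: map_append upt_add_eq_append[of 0 k "length (u n)", simplified])
  also have "map y [0..<k] = output_upto u n"
    using assms unfolding spells_def k_def by metis
  finally show ?thesis by (simp add: k_def output_upto_Suc)
qed

lemma spells_index:
  assumes "spells u y"
  shows "\<exists>n. length (output_upto u n) \<le> m \<and> m < length (output_upto u (Suc n))"
proof -
  define P where "P n \<longleftrightarrow> m < length (output_upto u n)" for n
  have "\<exists>n. P n"
    using assms unfolding spells_def infinite_output_def P_def by (meson Suc_le_eq)
  moreover have "\<not> P 0" by (simp add: P_def output_upto_def)
  ultimately obtain n where "\<not> P n" "P (Suc n)"
    using exists_least_lemma[of P] by blast
  then show ?thesis by (intro exI[of _ n]) (simp add: P_def)
qed

text \<open>Blocks are finite and cover all positions, so recurrence within positions and recurrence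
  within blocks agree even if some blocks are empty. On edge words this transfers the acceptance
  condition of the second machine.\<close>

lemma spells_infinitely_often:
  assumes "spells u y"
  shows "infinite {n. \<exists>e\<in>set (u n). P e} \<longleftrightarrow> infinite {m. P (y m)}"
proof
  assume inf: "infinite {n. \<exists>e\<in>set (u n). P e}"
  show "infinite {m. P (y m)}"
    unfolding infinite_nat_iff_unbounded_le
  proof
    fix m
    obtain N where N: "m \<le> length (output_upto u N)"
      using assms unfolding spells_def infinite_output_def by blast
    obtain n e where "N \<le> n" and e: "e \<in> set (u n)" "P e"
      using inf unfolding infinite_nat_iff_unbounded_le by blast
    then obtain i where "length (output_upto u n) \<le> i" "e = y i"
      using spells_block[OF assms, of n] by auto
    moreover have "length (output_upto u N) \<le> length (output_upto u n)"
      by (rule length_output_upto_mono[OF \<open>N \<le> n\<close>])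
    ultimately show "\<exists>n\<ge>m. n \<in> {m. P (y m)}"
      using N e by (intro exI[of _ i]) simp
  qed
next
  assume inf: "infinite {m. P (y m)}"
  show "infinite {n. \<exists>e\<in>set (u n). P e}"
    unfolding infinite_nat_iff_unbounded_le
  proof
    fix N
    obtain m where m: "length (output_upto u N) \<le> m" "P (y m)"
      using inf unfolding infinite_nat_iff_unbounded_le by blast
    obtain n where n: "length (output_upto u n) \<le> m" "m < length (output_upto u (Suc n))"
      using spells_index[OF assms] by blast
    have "N \<le> n"
    proof (rule ccontr)
      assume "\<not> N \<le> n"
      then have "Suc n \<le> N" by simp
      from length_output_upto_mono[OF this, of u] m(1) n(2) show False by simp
    qed
    moreover have "y m \<in> set (u n)"
      using n by (subst spells_block[OF assms]) auto
    ultimately show "\<exists>n'\<ge>N. n' \<in> {n. \<exists>e\<in>set (u n). P e}" using m(2) by blast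
  qed
qed

text \<open>For edges \<open>y m\<close> and \<open>f\<close> the output of an edge, this compares
  the output of the second machine per letter read by it with the output per letter read by the
  composite. Coarse prefixes are the fine prefixes at block boundaries, and these boundaries are
  cofinal.\<close>

lemma spells_regroup:
  assumes u: "spells u y" and inf: "infinite_output (\<lambda>m. f (y m))"
  shows "spells (\<lambda>n. concat (map f (u n))) z \<longleftrightarrow> spells (\<lambda>m. f (y m)) z"
    and "infinite_output (\<lambda>n. concat (map f (u n)))"
proof -
  let ?v = "\<lambda>m. f (y m)" and ?k = "\<lambda>n. length (output_upto u n)"
  have grp: "output_upto (\<lambda>n. concat (map f (u n))) n = output_upto ?v (?k n)" for n
  proof -
    have "output_upto u n = map y [0..<?k n]" using u unfolding spells_def by blast
    then have "concat (map f (output_upto u n)) = concat (map ?v [0..<?k n])"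
      by (metis (no_types, lifting) list.map_comp comp_apply map_eq_conv)
    then show ?thesis unfolding output_upto_concat by (simp add: output_upto_def)
  qed
  have cofinal: "\<exists>n. m \<le> ?k n" for m
    using u unfolding spells_def infinite_output_def by blast
  show inf': "infinite_output (\<lambda>n. concat (map f (u n)))"
    unfolding infinite_output_def grp
  proof
    fix k
    obtain m where "k \<le> length (output_upto ?v m)"
      using inf unfolding infinite_output_def by blast
    moreover obtain n where "m \<le> ?k n" using cofinal by blast
    ultimately show "\<exists>n. k \<le> length (output_upto ?v (?k n))"
      using length_output_upto_mono[of m "?k n" ?v] by (intro exI[of _ n]) simp
  qed
  show "spells (\<lambda>n. concat (map f (u n))) z \<longleftrightarrow> spells ?v z"
  proof
    assume "spells ?v z"
    then show "spells (\<lambda>n. concat (map f (u n))) z"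
      using inf' unfolding spells_def grp by blast
  next
    assume s: "spells (\<lambda>n. concat (map f (u n))) z"
    \<comment> \<open>A fine prefix that may end inside a block is obtained by truncating one that
      ends at a later boundary.\<close>
    have "output_upto ?v m = map z [0..<length (output_upto ?v m)]" for m
    proof -
      obtain n where "m \<le> ?k n" using cofinal by blast
      then obtain s' where s': "output_upto ?v (?k n) = output_upto ?v m @ s'"
        using output_upto_prefix by blast
      have "output_upto ?v (?k n) = map z [0..<length (output_upto ?v (?k n))]"
        using s unfolding spells_def grp by blast
      then have "take (length (output_upto ?v m)) (output_upto ?v m @ s') =
          take (length (output_upto ?v m)) (map z [0..<length (output_upto ?v m @ s')])"
        unfolding s' by (rule arg_cong)
      then show ?thesis by (simp add: take_map)
    qed
    with inf show "spells ?v z" unfolding spells_def by blast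
  qed
qed

section \<open>Degeneralisation of two recurrence conditions\<close>

text \<open>An event \<open>G\<close> seen with the flag clear sets it, and only \<open>V\<close>
  clears it again, so between two such events some \<open>V\<close> occurs. Conversely the flag
  cannot get stuck: while set it is cleared by the next \<open>V\<close>, while clear it is set by
  the next \<open>G\<close>. A \<open>V\<close> that occurs with the flag clear is merely
  missed.\<close>

lemma infinitely_often_flag:
  assumes 0: "\<not> fl 0" and Suc: "\<And>n. fl (Suc n) = (if fl n then \<not> V n else G n)"
  shows "infinite {n. \<not> fl n \<and> G n} \<longleftrightarrow> infinite {n. G n} \<and> infinite {n :: nat. V n}"
proof (intro iffI conjI)
  assume inf: "infinite {n. \<not> fl n \<and> G n}"
  then show "infinite {n. G n}" by (rule infinite_super[rotated]) auto
  show "infinite {n. V n}"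
    unfolding infinite_nat_iff_unbounded_le
  proof (rule allI, rule ccontr)
    fix m assume "\<not> (\<exists>n\<ge>m. n \<in> {n. V n})"
    then have V: "\<forall>n\<ge>m. \<not> V n" by blast
    obtain n where n: "m \<le> n" "\<not> fl n" "G n"
      using inf unfolding infinite_nat_iff_unbounded_le by blast
    have fl: "fl k" if "Suc n \<le> k" for k
      using that by (induction k rule: dec_induct) (use n V Suc in auto)
    obtain k where "Suc n \<le> k" "\<not> fl k"
      using inf unfolding infinite_nat_iff_unbounded_le by blast
    with fl show False by blast
  qed
next
  assume inf: "infinite {n. G n} \<and> infinite {n. V n}"
  show "infinite {n. \<not> fl n \<and> G n}"
    unfolding infinite_nat_iff_unbounded_le
  proof (rule allI, rule ccontr)
    fix m assume "\<not> (\<exists>n\<ge>m. n \<in> {n. \<not> fl n \<and> G n})"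
    then have m: "\<forall>n\<ge>m. \<not> fl n \<longrightarrow> \<not> G n" by blast
    have stay: "\<not> fl k" if "\<not> fl n" "m \<le> n" "n \<le> k" for n k
      using that(3) by (induction k rule: dec_induct) (use that m Suc in auto)
    obtain n where n: "m \<le> n" "V n"
      using inf unfolding infinite_nat_iff_unbounded_le by blast
    \<comment> \<open>Either the flag is set and \<open>V n\<close> clears it, or it is clear and
      stays so, as \<open>G n\<close> would contradict the choice of \<open>m\<close>. From here the
      next \<open>G\<close> meets a clear flag.\<close>
    have "\<not> fl (Suc n)"
    proof (cases "fl n")
      case True with n Suc show ?thesis by simp
    next
      case False with n m Suc show ?thesis by simp
    qed
    moreover obtain k where "Suc n \<le> k" "G k"
      using inf unfolding infinite_nat_iff_unbounded_le by blast
    ultimately have "\<not> fl k" using stay[of "Suc n" k] n by simp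
    with m n \<open>Suc n \<le> k\<close> \<open>G k\<close> show False by simp
  qed
qed

section \<open>The composed transducer\<close>

text \<open>Makes a list of locations a total valuation, so that \<open>sat\<close> itself can be
  applied with locations in the role of data. Tests of a transducer satisfying
  \<open>bounded_nrt M\<close> inspect only positions below \<open>M\<close>, where a list of length
  \<open>M\<close> does not fall back on the default.\<close>

abbreviation val :: "nat list \<Rightarrow> nat \<Rightarrow> nat" where
  "val \<rho> \<equiv> nth_default 0 \<rho>"

definition upd :: "nat \<Rightarrow> nat list \<Rightarrow> nat set \<Rightarrow> nat \<Rightarrow> nat list" where
  "upd M \<rho> S l = map (\<lambda>r. if r \<in> S then l else val \<rho> r) [0..<M]"

text \<open>
  State of the second machine, location of each of its registers, output produced so far within
  the block, and whether an accepting state has been left within the block.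
\<close>

type_synonym 'c block_config = "nat \<times> nat list \<times> ('c \<times> nat) list \<times> bool"

text \<open>The bit looks at the state being left rather than entered: every configuration of a run,
  the initial one included, is left by exactly one move, so no visit is lost or counted twice at
  block boundaries.\<close>

definition block_step ::
    "('b, 'c) nrt \<Rightarrow> nat \<Rightarrow> 'c block_config \<Rightarrow> 'b \<times> nat \<Rightarrow> 'c block_config set" where
  "block_step T M = (\<lambda>(q, \<rho>, u, v) (b, l).
     (\<lambda>(_, _, _, asgn, out, q').
        (q', upd M \<rho> asgn l, u @ map (\<lambda>(c, r). (c, val (upd M \<rho> asgn l) r)) out,
         v \<or> q \<in> accepting T)) `
     {t \<in> delta T. case t of (q1, b1, \<phi>, _) \<Rightarrow> q1 = q \<and> b1 = b \<and> sat (val \<rho>) l \<phi>})"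

primrec block_run ::
    "('b, 'c) nrt \<Rightarrow> nat \<Rightarrow> ('b \<times> nat) list \<Rightarrow> 'c block_config \<Rightarrow> 'c block_config set" where
  "block_run T M [] c = {c}"
| "block_run T M (x # w) c = (\<Union>c'\<in>block_step T M c x. block_run T M w c')"

text \<open>If \<open>p\<close> does not occur in \<open>us\<close>, the test says that the current datum is new.\<close>

primrec location_test :: "nat list \<Rightarrow> nat \<Rightarrow> test" where
  "location_test [] p = Top"
| "location_test (u # us) p =
     Conj (if u = p then Equal u else Unequal u) (location_test us p)"

text \<open>
  States of both machines, the flag of the degeneralised acceptance condition (set while waiting
  for an accepting state of the second machine), and the locations of the registers of both.
\<close>

type_synonym comp_state = "nat \<times> nat \<times> bool \<times> nat list \<times> nat list"

definition comp_states :: "nat set \<Rightarrow> nat set \<Rightarrow> nat \<Rightarrow> comp_state set" where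
  "comp_states Qg Qf M =
     Qg \<times> Qf \<times> UNIV \<times> {\<rho>. length \<rho> = M \<and> set \<rho> \<subseteq> {..<Suc (2 * M)}} \<times>
       {\<rho>. length \<rho> = M \<and> set \<rho> \<subseteq> {..<Suc (2 * M)}}"

text \<open>The test \<open>\<phi>\<close> is decided while the transition is built; the only test
  left for run time verifies the guess \<open>p\<close>. Assigning \<open>p\<close> every time is
  harmless, because a location in use that passes this test already holds the datum.\<close>

definition comp_transitions ::
    "('a, 'b) nrt \<Rightarrow> ('b, 'c) nrt \<Rightarrow> nat \<Rightarrow> comp_state \<Rightarrow> nat \<Rightarrow> ('a, 'b) transition \<Rightarrow>
     ('a, 'c) transition set" where
  "comp_transitions Tg Tf M = (\<lambda>(qg, qf, fl, \<rho>g, \<rho>f) p (q, a, \<phi>, asgn, out, q').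
     if q = qg \<and> sat (val \<rho>g) p \<phi> then
       (\<lambda>(qf', \<rho>f', u, v).
          (enc (qg, qf, fl, \<rho>g, \<rho>f), a, location_test (\<rho>g @ \<rho>f) p, {p}, u,
           enc (q', qf', if fl then \<not> v else qg \<in> accepting Tg, upd M \<rho>g asgn p, \<rho>f'))) `
       block_run Tf M (map (\<lambda>(b, r). (b, val (upd M \<rho>g asgn p) r)) out) (qf, \<rho>f, [], False)
     else {})"

text \<open>The code of a set is the sum of the powers \<open>2 ^ r\<close> of its members and so
  exceeds each of them. It can be read off the code of a transducer directly, with no maximum to be
  computed.\<close>

definition reg_bound :: "('a, 'b) nrt \<Rightarrow> ('b, 'c) nrt \<Rightarrow> nat" where
  "reg_bound Tg Tf = set_encode (regs Tg) + set_encode (regs Tf)"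

text \<open>
  At most \<open>2 * M\<close> locations are in use at any time, so with one more register there is always
  a free one for a new datum.
\<close>

definition compose :: "('a, 'b) nrt \<Rightarrow> ('b, 'c) nrt \<Rightarrow> ('a, 'c) nrt" where
  "compose Tg Tf = (let M = reg_bound Tg Tf; S = comp_states (states Tg) (states Tf) M in
     \<lparr>states = enc ` S,
      regs = {..<Suc (2 * M)},
      initial = enc (initial Tg, initial Tf, False, replicate M (0 :: nat), replicate M (0 :: nat)),
      accepting = enc ` {(qg, qf, fl, \<rho>g, \<rho>f) \<in> S. \<not> fl \<and> qg \<in> accepting Tg},
      delta = (\<Union>s\<in>S. \<Union>p\<in>{..<Suc (2 * M)}. \<Union>t\<in>delta Tg. comp_transitions Tg Tf M s p t)\<rparr>)"

lemma length_upd [simp]: "length (upd M \<rho> S l) = M"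
  by (simp add: upd_def)

lemma set_upd: "length \<rho> = M \<Longrightarrow> set (upd M \<rho> S l) \<subseteq> insert l (set \<rho>)"
  by (auto simp: upd_def nth_default_nth)

lemma sat_location_test:
  "sat \<theta> d (location_test us p) \<longleftrightarrow> (\<forall>u\<in>set us. \<theta> u = d \<longleftrightarrow> u = p)"
  by (induction us) auto

lemma test_regs_location_test [simp]: "test_regs (location_test us p) = set us"
  by (induction us) auto

text \<open>The relation \<open>step\<close> over the data type \<open>nat\<close> of locations,
  with valuations cut down to lists of length \<open>M\<close>; it serves both machines.\<close>

definition abs_step ::
    "('a, 'b) nrt \<Rightarrow> nat \<Rightarrow> nat \<times> nat list \<Rightarrow> 'a \<times> nat \<Rightarrow> ('b \<times> nat) list \<Rightarrow> nat \<times> nat list \<Rightarrow> bool"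
  where
  "abs_step T M c x w c' \<longleftrightarrow>
     (\<exists>\<phi> asgn out. (fst c, fst x, \<phi>, asgn, out, fst c') \<in> delta T \<and> sat (val (snd c)) (snd x) \<phi> \<and>
        snd c' = upd M (snd c) asgn (snd x) \<and> w = map (\<lambda>(b, r). (b, val (snd c') r)) out)"

lemma mem_block_step:
  "(q', \<rho>', u', v') \<in> block_step T M (q, \<rho>, u, v) x \<longleftrightarrow>
     (\<exists>w. abs_step T M (q, \<rho>) x w (q', \<rho>') \<and> u' = u @ w \<and> v' = (v \<or> q \<in> accepting T))"
  by (cases x) (force simp: block_step_def abs_step_def image_iff)

lemma mem_comp_transitions:
  "(\<exists>t\<in>delta Tg. z \<in> comp_transitions Tg Tf M (qg, qf, fl, \<rho>g, \<rho>f) p t) \<longleftrightarrow>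
     (\<exists>a w qg' \<rho>g' qf' \<rho>f' u v.
        abs_step Tg M (qg, \<rho>g) (a, p) w (qg', \<rho>g') \<and>
        (qf', \<rho>f', u, v) \<in> block_run Tf M w (qf, \<rho>f, [], False) \<and>
        z = (enc (qg, qf, fl, \<rho>g, \<rho>f), a, location_test (\<rho>g @ \<rho>f) p, {p}, u,
             enc (qg', qf', if fl then \<not> v else qg \<in> accepting Tg, \<rho>g', \<rho>f')))"
  (is "?L = ?R")
proof
  assume ?L
  then obtain a \<phi> asgn out q' c where
    "(qg, a, \<phi>, asgn, out, q') \<in> delta Tg" "sat (val \<rho>g) p \<phi>"
    "c \<in> block_run Tf M (map (\<lambda>(b, r). (b, val (upd M \<rho>g asgn p) r)) out) (qf, \<rho>f, [], False)"
    "z = (case c of (qf', \<rho>f', u, v) \<Rightarrow>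
          (enc (qg, qf, fl, \<rho>g, \<rho>f), a, location_test (\<rho>g @ \<rho>f) p, {p}, u,
           enc (q', qf', if fl then \<not> v else qg \<in> accepting Tg, upd M \<rho>g asgn p, \<rho>f')))"
    unfolding comp_transitions_def by (auto split: if_splits)
  moreover obtain qf' \<rho>f' u v where "c = (qf', \<rho>f', u, v)" by (cases c)
  moreover from calculation(1,2) have "abs_step Tg M (qg, \<rho>g) (a, p)
      (map (\<lambda>(b, r). (b, val (upd M \<rho>g asgn p) r)) out) (q', upd M \<rho>g asgn p)"
    unfolding abs_step_def by auto
  ultimately show ?R by (simp only: prod.case) blast
next
  assume ?R
  then obtain a w qg' \<rho>g' qf' \<rho>f' u v where
    *: "abs_step Tg M (qg, \<rho>g) (a, p) w (qg', \<rho>g')"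
    "(qf', \<rho>f', u, v) \<in> block_run Tf M w (qf, \<rho>f, [], False)"
    "z = (enc (qg, qf, fl, \<rho>g, \<rho>f), a, location_test (\<rho>g @ \<rho>f) p, {p}, u,
             enc (qg', qf', if fl then \<not> v else qg \<in> accepting Tg, \<rho>g', \<rho>f'))"
    by blast
  from *(1) obtain \<phi> asgn out where t: "(qg, a, \<phi>, asgn, out, qg') \<in> delta Tg" "sat (val \<rho>g) p \<phi>"
    "\<rho>g' = upd M \<rho>g asgn p" "w = map (\<lambda>(b, r). (b, val \<rho>g' r)) out"
    by (auto simp: abs_step_def)
  have "z \<in> comp_transitions Tg Tf M (qg, qf, fl, \<rho>g, \<rho>f) p (qg, a, \<phi>, asgn, out, qg')"
    using t(2-4) *(2,3) unfolding comp_transitions_def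
    by (auto intro!: rev_image_eqI[of "(qf', \<rho>f', u, v)"])
  with t(1) show ?L by blast
qed

section \<open>Correctness of the composed transducer\<close>

text \<open>Here \<open>\<theta>\<close> belongs to the composite and \<open>\<tau>\<close> to a
  simulated machine. Registers from \<open>M\<close> on are left free, since they are never
  inspected.\<close>

definition reads :: "nat \<Rightarrow> (nat \<Rightarrow> 'd) \<Rightarrow> nat list \<Rightarrow> (nat \<Rightarrow> 'd) \<Rightarrow> bool" where
  "reads M \<theta> \<rho> \<tau> \<longleftrightarrow> length \<rho> = M \<and> (\<forall>r<M. \<tau> r = \<theta> (\<rho> ! r))"

definition bounded_nrt :: "nat \<Rightarrow> ('a, 'b) nrt \<Rightarrow> bool" where
  "bounded_nrt M T \<longleftrightarrow> (\<forall>(q, a, \<phi>, asgn, out, q') \<in> delta T.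
     q' \<in> states T \<and> test_regs \<phi> \<subseteq> {..<M} \<and> snd ` set out \<subseteq> {..<M})"

lemma bounded_nrt:
  assumes "wf_nrt A B T" "regs T \<subseteq> {..<M}" shows "bounded_nrt M T"
  using assms unfolding wf_nrt_def bounded_nrt_def by fastforce

text \<open>An atom compares the data at two locations of \<open>L\<close>, and by injectivity this
  is comparing the locations. \<open>L\<close> holds the location of the current datum besides those
  in use.\<close>

lemma sat_reads:
  assumes "reads M \<theta> \<rho> \<tau>" "inj_on \<theta> L" "set \<rho> \<subseteq> L" "l \<in> L"
  shows "test_regs \<phi> \<subseteq> {..<M} \<Longrightarrow> sat \<tau> (\<theta> l) \<phi> \<longleftrightarrow> sat (val \<rho>) l \<phi>"
proof (induction \<phi>)
  case (Equal r)
  then have "r < M" by simp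
  moreover from this assms have "\<rho> ! r \<in> L" by (auto simp: reads_def)
  ultimately show ?case using assms by (simp add: reads_def nth_default_nth inj_on_eq_iff)
next
  case (Unequal r)
  then have "r < M" by simp
  moreover from this assms have "\<rho> ! r \<in> L" by (auto simp: reads_def)
  ultimately show ?case using assms by (simp add: reads_def nth_default_nth inj_on_eq_iff)
qed auto

lemma reads_upd:
  "reads M \<theta> \<rho> \<tau> \<Longrightarrow> reads M \<theta> (upd M \<rho> S l) (\<lambda>r. if r \<in> S then \<theta> l else \<tau> r)"
  by (auto simp: reads_def upd_def nth_default_nth)

lemma map_reads:
  assumes "reads M \<theta> \<rho> \<tau>" "snd ` set out \<subseteq> {..<M}"
  shows "map (\<lambda>(b, r). (b, \<tau> r)) out = map (apsnd \<theta>) (map (\<lambda>(b, r). (b, val \<rho> r)) out)"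
  using assms by (auto simp: reads_def nth_default_nth image_subset_iff)

text \<open>A symbolic step brings in no location but that of the current datum. Hence a whole block
  stays inside one set \<open>L\<close> on which a single valuation is injective.\<close>

lemma abs_step_locations:
  assumes "bounded_nrt M T" "abs_step T M (q, \<rho>) (a, l) w (q', \<rho>')" "length \<rho> = M"
  shows "q' \<in> states T" "length \<rho>' = M" "set \<rho>' \<subseteq> insert l (set \<rho>)" "snd ` set w \<subseteq> set \<rho>'"
proof -
  from assms(2) obtain \<phi> asgn out where t: "(q, a, \<phi>, asgn, out, q') \<in> delta T"
    "\<rho>' = upd M \<rho> asgn l" "w = map (\<lambda>(b, r). (b, val \<rho>' r)) out"
    by (auto simp: abs_step_def)
  show "length \<rho>' = M" "set \<rho>' \<subseteq> insert l (set \<rho>)"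
    using t(2) set_upd[OF assms(3)] by simp_all
  have "q' \<in> states T \<and> snd ` set out \<subseteq> {..<M}"
    using assms(1) t(1) unfolding bounded_nrt_def by fastforce
  then show "q' \<in> states T" "snd ` set w \<subseteq> set \<rho>'"
    using \<open>length \<rho>' = M\<close> by (auto simp: t(3) nth_default_nth image_subset_iff)
qed

lemma step_of_abs_step:
  assumes T: "bounded_nrt M T" and s: "abs_step T M (q, \<rho>) (a, l) w (q', \<rho>')"
    and r: "reads M \<theta> \<rho> \<tau>" and L: "inj_on \<theta> L" "set \<rho> \<subseteq> L" "l \<in> L"
  shows "\<exists>\<tau>'. step T (q, \<tau>) (a, \<theta> l) (map (apsnd \<theta>) w) (q', \<tau>') \<and> reads M \<theta> \<rho>' \<tau>'"
proof -
  from s obtain \<phi> asgn out where t: "(q, a, \<phi>, asgn, out, q') \<in> delta T" "sat (val \<rho>) l \<phi>"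
    "\<rho>' = upd M \<rho> asgn l" "w = map (\<lambda>(b, r). (b, val \<rho>' r)) out"
    by (auto simp: abs_step_def)
  define \<tau>' where "\<tau>' = (\<lambda>r. if r \<in> asgn then \<theta> l else \<tau> r)"
  have b: "test_regs \<phi> \<subseteq> {..<M}" "snd ` set out \<subseteq> {..<M}"
    using T t(1) unfolding bounded_nrt_def by fastforce+
  have r': "reads M \<theta> \<rho>' \<tau>'" unfolding t(3) \<tau>'_def by (rule reads_upd[OF r])
  have "step T (q, \<tau>) (a, \<theta> l) (map (\<lambda>(b, r). (b, \<tau>' r)) out) (q', \<tau>')"
    using t(1,2) sat_reads[OF r L b(1)] \<tau>'_def by (intro step.intros) auto
  with r' show ?thesis unfolding t(4) map_reads[OF r' b(2)] by blast
qed

lemma abs_step_of_step: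
  assumes T: "bounded_nrt M T" and s: "step T (q, \<tau>) (a, \<theta> l) w c'"
    and r: "reads M \<theta> \<rho> \<tau>" and L: "inj_on \<theta> L" "set \<rho> \<subseteq> L" "l \<in> L"
  shows "\<exists>u \<rho>'. abs_step T M (q, \<rho>) (a, l) u (fst c', \<rho>') \<and> w = map (apsnd \<theta>) u \<and>
    reads M \<theta> \<rho>' (snd c')"
proof -
  from s obtain \<phi> asgn out q' \<tau>' where t: "(q, a, \<phi>, asgn, out, q') \<in> delta T" "sat \<tau> (\<theta> l) \<phi>"
    "\<tau>' = (\<lambda>r. if r \<in> asgn then \<theta> l else \<tau> r)" "w = map (\<lambda>(b, r). (b, \<tau>' r)) out"
    and c': "c' = (q', \<tau>')"
    by (auto elim!: step.cases)
  define \<rho>' where "\<rho>' = upd M \<rho> asgn l"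
  have b: "test_regs \<phi> \<subseteq> {..<M}" "snd ` set out \<subseteq> {..<M}"
    using T t(1) unfolding bounded_nrt_def by fastforce+
  have r': "reads M \<theta> \<rho>' \<tau>'" unfolding t(3) \<rho>'_def by (rule reads_upd[OF r])
  have "abs_step T M (q, \<rho>) (a, l) (map (\<lambda>(b, r). (b, val \<rho>' r)) out) (q', \<rho>')"
    using t(1,2) sat_reads[OF r L b(1)] unfolding abs_step_def \<rho>'_def
    by (intro exI[of _ \<phi>] exI[of _ asgn] exI[of _ out]) simp
  with r' show ?thesis unfolding t(4) map_reads[OF r' b(2)] c' fst_conv snd_conv by blast
qed

text \<open>Keeping all four parts of a move together means that one cutting of a word of edges cuts
  the states, the inputs and the outputs of a run consistently.\<close>

type_synonym ('b, 'c, 'd) edge =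
  "(nat \<times> (nat \<Rightarrow> 'd)) \<times> ('b \<times> 'd) \<times> ('c \<times> 'd) list \<times> (nat \<times> (nat \<Rightarrow> 'd))"

abbreviation edge_src :: "('b, 'c, 'd) edge \<Rightarrow> nat \<times> (nat \<Rightarrow> 'd)" where
  "edge_src e \<equiv> fst e"

abbreviation edge_in :: "('b, 'c, 'd) edge \<Rightarrow> 'b \<times> 'd" where
  "edge_in e \<equiv> fst (snd e)"

abbreviation edge_out :: "('b, 'c, 'd) edge \<Rightarrow> ('c \<times> 'd) list" where
  "edge_out e \<equiv> fst (snd (snd e))"

abbreviation edge_tgt :: "('b, 'c, 'd) edge \<Rightarrow> nat \<times> (nat \<Rightarrow> 'd)" where
  "edge_tgt e \<equiv> snd (snd (snd e))"

primrec path :: "('b, 'c) nrt \<Rightarrow> nat \<times> (nat \<Rightarrow> 'd) \<Rightarrow> ('b, 'c, 'd) edge list \<Rightarrow>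
    nat \<times> (nat \<Rightarrow> 'd) \<Rightarrow> bool" where
  "path T c [] c' \<longleftrightarrow> c' = c"
| "path T c (e # es) c' \<longleftrightarrow>
     edge_src e = c \<and> step T c (edge_in e) (edge_out e) (edge_tgt e) \<and> path T (edge_tgt e) es c'"

lemma path_append: "path T c (xs @ ys) c' \<longleftrightarrow> (\<exists>c''. path T c xs c'' \<and> path T c'' ys c')"
  by (induction xs arbitrary: c) auto

lemma path_step: "path T c es c' \<Longrightarrow> e \<in> set es \<Longrightarrow>
    step T (edge_src e) (edge_in e) (edge_out e) (edge_tgt e)"
  by (induction es arbitrary: c) auto

lemma path_hd: "path T c es c' \<Longrightarrow> es \<noteq> [] \<Longrightarrow> edge_src (es ! 0) = c"
  by (cases es) auto

lemma path_adjacent: "path T c es c' \<Longrightarrow> Suc i < length es \<Longrightarrow> edge_src (es ! Suc i) = edge_tgt (es ! i)"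
proof (induction es arbitrary: c i)
  case (Cons e es)
  show ?case
  proof (cases i)
    case 0
    with Cons.prems show ?thesis by (auto dest: path_hd)
  next
    case (Suc j)
    with Cons.prems Cons.IH[of "edge_tgt e" j] show ?thesis by simp
  qed
qed simp

text \<open>Within a block the registers of the composite do not change, so one
  \<open>\<theta>\<close> interprets every symbolic step. Locations that the second machine has
  meanwhile dropped still lie in \<open>L\<close>, which keeps outputs written earlier in the block
  meaningful.\<close>

lemma path_of_block_run:
  assumes T: "bounded_nrt M T" and L: "inj_on \<theta> L"
  shows "(q', \<rho>', u', v') \<in> block_run T M w (q, \<rho>, u, v) \<Longrightarrow> reads M \<theta> \<rho> \<tau> \<Longrightarrow> set \<rho> \<subseteq> L \<Longrightarrow>
    snd ` set w \<subseteq> L \<Longrightarrow> q \<in> states T \<Longrightarrow>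
    \<exists>es \<tau>' x. path T (q, \<tau>) es (q', \<tau>') \<and> map edge_in es = map (apsnd \<theta>) w \<and>
      reads M \<theta> \<rho>' \<tau>' \<and> set \<rho>' \<subseteq> L \<and> q' \<in> states T \<and> u' = u @ x \<and> snd ` set x \<subseteq> L \<and>
      map (apsnd \<theta>) x = concat (map edge_out es) \<and>
      v' = (v \<or> (\<exists>e\<in>set es. fst (edge_src e) \<in> accepting T))"
proof (induction w arbitrary: q \<rho> u v \<tau>)
  case Nil
  then show ?case
    by (intro exI[of _ "[]"] exI[of _ \<tau>]) simp
next
  case (Cons bl w)
  obtain b l where bl: "bl = (b, l)" by (cases bl)
  with Cons.prems(1) obtain q1 \<rho>1 y where
    s: "abs_step T M (q, \<rho>) (b, l) y (q1, \<rho>1)" and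
    run: "(q', \<rho>', u', v') \<in> block_run T M w (q1, \<rho>1, u @ y, v \<or> q \<in> accepting T)"
    by (auto simp: mem_block_step)
  have lL: "l \<in> L" "snd ` set w \<subseteq> L" using Cons.prems(4) bl by auto
  obtain \<tau>1 where st: "step T (q, \<tau>) (b, \<theta> l) (map (apsnd \<theta>) y) (q1, \<tau>1)"
    and r1: "reads M \<theta> \<rho>1 \<tau>1"
    using step_of_abs_step[OF T s Cons.prems(2) L Cons.prems(3) lL(1)] by blast
  have "length \<rho> = M" using Cons.prems(2) by (simp add: reads_def)
  note loc = abs_step_locations[OF T s this]
  have "set \<rho>1 \<subseteq> L" using loc(3) Cons.prems(3) lL(1) by blast
  from Cons.IH[OF run r1 this lL(2) loc(1)] obtain es \<tau>' x where
    IH: "path T (q1, \<tau>1) es (q', \<tau>')" "map edge_in es = map (apsnd \<theta>) w"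
      "reads M \<theta> \<rho>' \<tau>'" "set \<rho>' \<subseteq> L" "q' \<in> states T" "u' = (u @ y) @ x" "snd ` set x \<subseteq> L"
      "map (apsnd \<theta>) x = concat (map edge_out es)"
      "v' = ((v \<or> q \<in> accepting T) \<or> (\<exists>e\<in>set es. fst (edge_src e) \<in> accepting T))"
    by blast
  let ?e = "((q, \<tau>), (b, \<theta> l), map (apsnd \<theta>) y, (q1, \<tau>1))"
  show ?case
    by (rule exI[of _ "?e # es"], rule exI[of _ \<tau>'], rule exI[of _ "y @ x"])
      (use IH st bl loc(4) \<open>set \<rho>1 \<subseteq> L\<close> in auto)
qed

lemma block_run_of_path:
  assumes T: "bounded_nrt M T" and L: "inj_on \<theta> L"
  shows "path T c es c' \<Longrightarrow> map edge_in es = map (apsnd \<theta>) w \<Longrightarrow> reads M \<theta> \<rho> (snd c) \<Longrightarrow>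
    set \<rho> \<subseteq> L \<Longrightarrow> snd ` set w \<subseteq> L \<Longrightarrow> fst c \<in> states T \<Longrightarrow>
    \<exists>\<rho>' x. (fst c', \<rho>', u @ x, v \<or> (\<exists>e\<in>set es. fst (edge_src e) \<in> accepting T)) \<in>
        block_run T M w (fst c, \<rho>, u, v) \<and>
      reads M \<theta> \<rho>' (snd c') \<and> set \<rho>' \<subseteq> L \<and> fst c' \<in> states T \<and>
      map (apsnd \<theta>) x = concat (map edge_out es)"
proof (induction w arbitrary: c es \<rho> u v)
  case Nil
  then show ?case by simp
next
  case (Cons bl w)
  obtain b l where bl: "bl = (b, l)" by (cases bl)
  with Cons.prems(2) obtain e es' where es: "es = e # es'" "edge_in e = (b, \<theta> l)"
    "map edge_in es' = map (apsnd \<theta>) w"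
    by auto
  have lL: "l \<in> L" "snd ` set w \<subseteq> L" using Cons.prems(5) bl by auto
  have st: "step T (fst c, snd c) (b, \<theta> l) (edge_out e) (edge_tgt e)" and src: "edge_src e = c"
    and path': "path T (edge_tgt e) es' c'"
    using Cons.prems(1) es by auto
  obtain y \<rho>1 where s: "abs_step T M (fst c, \<rho>) (b, l) y (fst (edge_tgt e), \<rho>1)"
    and y: "edge_out e = map (apsnd \<theta>) y" and r1: "reads M \<theta> \<rho>1 (snd (edge_tgt e))"
    using abs_step_of_step[OF T st Cons.prems(3) L Cons.prems(4) lL(1)] by blast
  have "length \<rho> = M" using Cons.prems(3) by (simp add: reads_def)
  note loc = abs_step_locations[OF T s this]
  have "set \<rho>1 \<subseteq> L" using loc(3) Cons.prems(4) lL(1) by blast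
  from Cons.IH[OF path' es(3) r1 this lL(2) loc(1), of "u @ y" "v \<or> fst c \<in> accepting T"]
  obtain \<rho>' x where
    IH: "(fst c', \<rho>', (u @ y) @ x,
        (v \<or> fst c \<in> accepting T) \<or> (\<exists>e\<in>set es'. fst (edge_src e) \<in> accepting T)) \<in>
        block_run T M w (fst (edge_tgt e), \<rho>1, u @ y, v \<or> fst c \<in> accepting T)"
      "reads M \<theta> \<rho>' (snd c')" "set \<rho>' \<subseteq> L" "fst c' \<in> states T"
      "map (apsnd \<theta>) x = concat (map edge_out es')"
    by blast
  have "(fst (edge_tgt e), \<rho>1, u @ y, v \<or> fst c \<in> accepting T) \<in>
      block_step T M (fst c, \<rho>, u, v) (b, l)"
    using s by (auto simp: mem_block_step)
  then show ?case
    using IH y by (intro exI[of _ \<rho>'] exI[of _ "y @ x"]) (auto simp: bl es(1) src)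
qed

text \<open>
  Injectivity of \<open>\<theta>\<close> on the locations in use is what makes tests on locations equivalent to tests on
  the data stored there.
\<close>

definition comp_inv ::
    "('a, 'b) nrt \<Rightarrow> ('b, 'c) nrt \<Rightarrow> nat \<times> (nat \<Rightarrow> 'd) \<Rightarrow>
     (nat \<times> (nat \<Rightarrow> 'd)) \<times> (nat \<times> (nat \<Rightarrow> 'd)) \<times> bool \<Rightarrow> bool" where
  "comp_inv Tg Tf = (\<lambda>(s, \<theta>) (cg, cf, fl).
     \<exists>\<rho>g \<rho>f. s = enc (fst cg, fst cf, fl, \<rho>g, \<rho>f) \<and>
       (fst cg, fst cf, fl, \<rho>g, \<rho>f) \<in> comp_states (states Tg) (states Tf) (reg_bound Tg Tf) \<and>
       inj_on \<theta> (set \<rho>g \<union> set \<rho>f) \<and>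
       reads (reg_bound Tg Tf) \<theta> \<rho>g (snd cg) \<and> reads (reg_bound Tg Tf) \<theta> \<rho>f (snd cf))"

text \<open>The composite move without locations: both machines are concrete, and only blocks and
  flag remain. It separates the argument on data from the argument on infinite runs.\<close>

definition joint_step ::
    "('a, 'b) nrt \<Rightarrow> ('b, 'c) nrt \<Rightarrow>
     (nat \<times> (nat \<Rightarrow> 'd)) \<times> (nat \<times> (nat \<Rightarrow> 'd)) \<times> bool \<Rightarrow> 'a \<times> 'd \<Rightarrow> ('b, 'c, 'd) edge list \<Rightarrow>
     (nat \<times> (nat \<Rightarrow> 'd)) \<times> (nat \<times> (nat \<Rightarrow> 'd)) \<times> bool \<Rightarrow> bool" where
  "joint_step Tg Tf = (\<lambda>(cg, cf, fl) x es (cg', cf', fl').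
     step Tg cg x (map edge_in es) cg' \<and> path Tf cf es cf' \<and>
     fl' = (if fl then \<not> (\<exists>e\<in>set es. fst (edge_src e) \<in> accepting Tf) else fst cg \<in> accepting Tg))"

lemma regs_le_reg_bound:
  assumes "finite (regs Tg)" "finite (regs Tf)"
  shows "regs Tg \<subseteq> {..<reg_bound Tg Tf}" "regs Tf \<subseteq> {..<reg_bound Tg Tf}"
proof -
  have *: "r < set_encode S" if "r \<in> S" "finite S" for r S
  proof -
    have "r < 2 ^ r" by (rule less_exp)
    also have "2 ^ r = set_encode {r}" by simp
    also have "\<dots> \<le> set_encode S"
      unfolding set_encode_def by (rule sum_mono2) (use that in auto)
    finally show ?thesis .
  qed
  show "regs Tg \<subseteq> {..<reg_bound Tg Tf}" "regs Tf \<subseteq> {..<reg_bound Tg Tf}"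
    using *[OF _ assms(1)] *[OF _ assms(2)] unfolding reg_bound_def
    by (auto intro: trans_less_add1 trans_less_add2)
qed

lemma delta_compose:
  "(enc (qg, qf, fl, \<rho>g, \<rho>f), z) \<in> delta (compose Tg Tf) \<longleftrightarrow>
     (\<exists>p a w qg' \<rho>g' qf' \<rho>f' u v.
        (qg, qf, fl, \<rho>g, \<rho>f) \<in> comp_states (states Tg) (states Tf) (reg_bound Tg Tf) \<and>
        p < Suc (2 * reg_bound Tg Tf) \<and>
        abs_step Tg (reg_bound Tg Tf) (qg, \<rho>g) (a, p) w (qg', \<rho>g') \<and>
        (qf', \<rho>f', u, v) \<in> block_run Tf (reg_bound Tg Tf) w (qf, \<rho>f, [], False) \<and>
        z = (a, location_test (\<rho>g @ \<rho>f) p, {p}, u,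
             enc (qg', qf', if fl then \<not> v else qg \<in> accepting Tg, \<rho>g', \<rho>f')))"
  (is "?L \<longleftrightarrow> ?R")
proof
  assume ?L
  then obtain s p where
    s: "s \<in> comp_states (states Tg) (states Tf) (reg_bound Tg Tf)"
    and p: "p < Suc (2 * reg_bound Tg Tf)"
    and t: "\<exists>t\<in>delta Tg. (enc (qg, qf, fl, \<rho>g, \<rho>f), z) \<in>
       comp_transitions Tg Tf (reg_bound Tg Tf) s p t"
    by (simp add: compose_def Let_def) blast
  obtain qg1 qf1 fl1 \<rho>g1 \<rho>f1 where "s = (qg1, qf1, fl1, \<rho>g1, \<rho>f1)" by (cases s)
  with s p t[unfolded this mem_comp_transitions] show ?R by (elim exE conjE) (simp, blast)
next
  assume ?R
  then obtain p where s: "(qg, qf, fl, \<rho>g, \<rho>f) \<in> comp_states (states Tg) (states Tf) (reg_bound Tg Tf)"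
    and p: "p < Suc (2 * reg_bound Tg Tf)"
    and "\<exists>t\<in>delta Tg. (enc (qg, qf, fl, \<rho>g, \<rho>f), z) \<in>
       comp_transitions Tg Tf (reg_bound Tg Tf) (qg, qf, fl, \<rho>g, \<rho>f) p t"
    unfolding mem_comp_transitions by blast
  then show ?L unfolding compose_def Let_def by auto
qed

section \<open>Mutual simulation of the composite and of joint moves\<close>

locale nrt_pair =
  fixes A :: "'a set" and B :: "'b set" and C :: "'c set"
    and Tg :: "('a, 'b) nrt" and Tf :: "('b, 'c) nrt"
  assumes wf_Tg: "wf_nrt A B Tg" and wf_Tf: "wf_nrt B C Tf"
begin

abbreviation "M \<equiv> reg_bound Tg Tf"

lemma bounded: "bounded_nrt M Tg" "bounded_nrt M Tf"
proof -
  have "finite (regs Tg)" "finite (regs Tf)"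
    using wf_Tg wf_Tf by (auto simp: wf_nrt_def)
  from regs_le_reg_bound[OF this] show "bounded_nrt M Tg" "bounded_nrt M Tf"
    using bounded_nrt[OF wf_Tg] bounded_nrt[OF wf_Tf] by simp_all
qed

lemma compose_simulates_joint:
  assumes inv: "comp_inv Tg Tf c j" and st: "joint_step Tg Tf j x es j'"
  shows "\<exists>c'. step (compose Tg Tf) c x (concat (map edge_out es)) c' \<and> comp_inv Tg Tf c' j'"
proof -
  obtain s \<theta> where c: "c = (s, \<theta>)" by (cases c)
  obtain cg cf fl where j: "j = (cg, cf, fl)" by (cases j)
  obtain cg' cf' fl' where j': "j' = (cg', cf', fl')" by (cases j')
  obtain a d where x: "x = (a, d)" by (cases x)
  from inv obtain \<rho>g \<rho>f where s: "s = enc (fst cg, fst cf, fl, \<rho>g, \<rho>f)"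
    and S: "(fst cg, fst cf, fl, \<rho>g, \<rho>f) \<in> comp_states (states Tg) (states Tf) M"
    and inj: "inj_on \<theta> (set \<rho>g \<union> set \<rho>f)"
    and rg: "reads M \<theta> \<rho>g (snd cg)" and rf: "reads M \<theta> \<rho>f (snd cf)"
    unfolding comp_inv_def c j by auto
  from S have len: "length \<rho>g = M" "length \<rho>f = M"
    and sub: "set \<rho>g \<union> set \<rho>f \<subseteq> {..<Suc (2 * M)}"
    and Q: "fst cg \<in> states Tg" "fst cf \<in> states Tf"
    unfolding comp_states_def by auto
  \<comment> \<open>The right guess: the location already holding \<open>d\<close>, unique by
    injectivity, or else a free one, found by counting at most \<open>2 * M\<close> locations in use
    among \<open>2 * M + 1\<close>.\<close>
  have "\<exists>p < Suc (2 * M). \<forall>u \<in> set \<rho>g \<union> set \<rho>f. \<theta> u = d \<longleftrightarrow> u = p"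
  proof (cases "\<exists>u \<in> set \<rho>g \<union> set \<rho>f. \<theta> u = d")
    case True
    then obtain p where "p \<in> set \<rho>g \<union> set \<rho>f" "\<theta> p = d" by blast
    with sub inj show ?thesis by (intro exI[of _ p]) (auto simp: inj_on_def)
  next
    case False
    have "card (set \<rho>g \<union> set \<rho>f) \<le> 2 * M"
      using card_Un_le[of "set \<rho>g" "set \<rho>f"] card_length[of \<rho>g] card_length[of \<rho>f] len by simp
    then have "card (set \<rho>g \<union> set \<rho>f) < card {..<Suc (2 * M)}" by simp
    then have "\<not> {..<Suc (2 * M)} \<subseteq> set \<rho>g \<union> set \<rho>f"
      using card_mono[of "set \<rho>g \<union> set \<rho>f" "{..<Suc (2 * M)}"] by auto
    then obtain p where "p < Suc (2 * M)" "p \<notin> set \<rho>g \<union> set \<rho>f" by auto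
    with False show ?thesis by (intro exI[of _ p]) auto
  qed
  then obtain p where p: "p < Suc (2 * M)"
    and loc: "\<And>u. u \<in> set \<rho>g \<union> set \<rho>f \<Longrightarrow> \<theta> u = d \<longleftrightarrow> u = p" by blast
  define L where "L = insert p (set \<rho>g \<union> set \<rho>f)"
  define \<theta>' where "\<theta>' = (\<lambda>r. if r \<in> {p} then d else \<theta> r)"
  \<comment> \<open>If \<open>p\<close> was in use it held \<open>d\<close> before, so storing
    \<open>d\<close> there changes no location in use.\<close>
  have eq: "\<theta>' u = \<theta> u" if "u \<in> set \<rho>g \<union> set \<rho>f" for u using loc[OF that] by (auto simp: \<theta>'_def)
  have d: "d = \<theta>' p" by (simp add: \<theta>'_def)
  \<comment> \<open>\<open>p\<close> now holds \<open>d\<close>, and no other location in use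
    does.\<close>
  have injL: "inj_on \<theta>' L"
    using inj loc unfolding L_def inj_on_def by (auto simp: \<theta>'_def)
  have rg': "reads M \<theta>' \<rho>g (snd cg)" and rf': "reads M \<theta>' \<rho>f (snd cf)"
    using rg rf eq unfolding reads_def by simp_all
  from st have stg: "step Tg (fst cg, snd cg) (a, \<theta>' p) (map edge_in es) cg'"
    and pth: "path Tf cf es cf'"
    and fl': "fl' = (if fl then \<not> (\<exists>e\<in>set es. fst (edge_src e) \<in> accepting Tf) else fst cg \<in> accepting Tg)"
    unfolding joint_step_def j j' x d by auto
  have sL: "set \<rho>g \<subseteq> L" "set \<rho>f \<subseteq> L" "p \<in> L" by (auto simp: L_def)
  obtain w \<rho>g' where ag: "abs_step Tg M (fst cg, \<rho>g) (a, p) w (fst cg', \<rho>g')"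
    and w: "map edge_in es = map (apsnd \<theta>') w" and rg1: "reads M \<theta>' \<rho>g' (snd cg')"
    using abs_step_of_step[OF bounded(1) stg rg' injL sL(1,3)] by blast
  note locg = abs_step_locations[OF bounded(1) ag len(1)]
  have g'L: "set \<rho>g' \<subseteq> L" using locg(3) by (auto simp: L_def)
  have wL: "snd ` set w \<subseteq> L" using locg(4) g'L by blast
  obtain \<rho>f' u where br: "(fst cf', \<rho>f', u, \<exists>e\<in>set es. fst (edge_src e) \<in> accepting Tf) \<in>
        block_run Tf M w (fst cf, \<rho>f, [], False)"
    and rf1: "reads M \<theta>' \<rho>f' (snd cf')" and f'L: "set \<rho>f' \<subseteq> L" and Qf': "fst cf' \<in> states Tf"
    and u: "map (apsnd \<theta>') u = concat (map edge_out es)"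
    using block_run_of_path[OF bounded(2) injL pth w rf' sL(2) wL Q(2), of "[]" False]
    by auto
  have tr: "(s, a, location_test (\<rho>g @ \<rho>f) p, {p}, u, enc (fst cg', fst cf', fl', \<rho>g', \<rho>f')) \<in>
      delta (compose Tg Tf)"
    unfolding s delta_compose using S p ag br fl' by blast
  have "sat \<theta> d (location_test (\<rho>g @ \<rho>f) p)"
    using loc by (simp add: sat_location_test)
  from step.intros[OF tr this \<theta>'_def]
  have "step (compose Tg Tf) c x (concat (map edge_out es))
      (enc (fst cg', fst cf', fl', \<rho>g', \<rho>f'), \<theta>')"
    unfolding c x u[symmetric] by (simp add: apsnd_def map_prod_def)
  moreover have "comp_inv Tg Tf (enc (fst cg', fst cf', fl', \<rho>g', \<rho>f'), \<theta>') j'"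
  proof -
    have "L \<subseteq> {..<Suc (2 * M)}" using sub p by (auto simp: L_def)
    then have "(fst cg', fst cf', fl', \<rho>g', \<rho>f') \<in> comp_states (states Tg) (states Tf) M"
      using locg(1,2) Qf' g'L f'L rf1 by (auto simp: comp_states_def reads_def)
    moreover have "inj_on \<theta>' (set \<rho>g' \<union> set \<rho>f')"
      using g'L f'L by (intro inj_on_subset[OF injL]) simp
    ultimately show ?thesis
      unfolding comp_inv_def j' using rg1 rf1 by (simp del: enc_eq_iff) blast
  qed
  ultimately show ?thesis by blast
qed

lemma joint_simulates_compose:
  assumes inv: "comp_inv Tg Tf c j" and st: "step (compose Tg Tf) c x y c'"
  shows "\<exists>es j'. joint_step Tg Tf j x es j' \<and> y = concat (map edge_out es) \<and> comp_inv Tg Tf c' j'"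
proof -
  obtain s \<theta> where c: "c = (s, \<theta>)" by (cases c)
  obtain cg cf fl where j: "j = (cg, cf, fl)" by (cases j)
  obtain a0 d where x: "x = (a0, d)" by (cases x)
  from inv obtain \<rho>g \<rho>f where s: "s = enc (fst cg, fst cf, fl, \<rho>g, \<rho>f)"
    and S: "(fst cg, fst cf, fl, \<rho>g, \<rho>f) \<in> comp_states (states Tg) (states Tf) M"
    and inj: "inj_on \<theta> (set \<rho>g \<union> set \<rho>f)"
    and rg: "reads M \<theta> \<rho>g (snd cg)" and rf: "reads M \<theta> \<rho>f (snd cf)"
    unfolding comp_inv_def c j by auto
  from S have len: "length \<rho>g = M" "length \<rho>f = M"
    and sub: "set \<rho>g \<union> set \<rho>f \<subseteq> {..<Suc (2 * M)}"
    and Q: "fst cg \<in> states Tg" "fst cf \<in> states Tf"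
    unfolding comp_states_def by auto
  from st obtain \<phi> asgn u s' where
    tr: "(s, a0, \<phi>, asgn, u, s') \<in> delta (compose Tg Tf)" and sat: "sat \<theta> d \<phi>"
    and y: "y = map (\<lambda>(b, r). (b, if r \<in> asgn then d else \<theta> r)) u"
    and c': "c' = (s', \<lambda>r. if r \<in> asgn then d else \<theta> r)"
    unfolding c x by (auto elim!: step.cases)
  from tr[unfolded s delta_compose] obtain p w qg' \<rho>g' qf' \<rho>f' v where
    p: "p < Suc (2 * M)" and ag: "abs_step Tg M (fst cg, \<rho>g) (a0, p) w (qg', \<rho>g')"
    and br: "(qf', \<rho>f', u, v) \<in> block_run Tf M w (fst cf, \<rho>f, [], False)"
    and \<phi>: "\<phi> = location_test (\<rho>g @ \<rho>f) p" and asgn: "asgn = {p}"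
    and s': "s' = enc (qg', qf', if fl then \<not> v else fst cg \<in> accepting Tg, \<rho>g', \<rho>f')"
    by blast
  \<comment> \<open>The passed test supplies what the choice of \<open>p\<close> supplied in the
    converse simulation.\<close>
  have loc: "\<theta> u = d \<longleftrightarrow> u = p" if "u \<in> set \<rho>g \<union> set \<rho>f" for u
    using sat that unfolding \<phi> sat_location_test by auto
  define L where "L = insert p (set \<rho>g \<union> set \<rho>f)"
  define \<theta>' where "\<theta>' = (\<lambda>r. if r \<in> {p} then d else \<theta> r)"
  have eq: "\<theta>' u = \<theta> u" if "u \<in> set \<rho>g \<union> set \<rho>f" for u using loc[OF that] by (auto simp: \<theta>'_def)
  have d: "d = \<theta>' p" by (simp add: \<theta>'_def)
  have injL: "inj_on \<theta>' L"
    using inj loc unfolding L_def inj_on_def by (auto simp: \<theta>'_def)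
  have rg': "reads M \<theta>' \<rho>g (snd cg)" and rf': "reads M \<theta>' \<rho>f (snd cf)"
    using rg rf eq unfolding reads_def by simp_all
  have sL: "set \<rho>g \<subseteq> L" "set \<rho>f \<subseteq> L" "p \<in> L" by (auto simp: L_def)
  obtain \<tau>g' where stg: "step Tg (fst cg, snd cg) (a0, \<theta>' p) (map (apsnd \<theta>') w) (qg', \<tau>g')"
    and rg1: "reads M \<theta>' \<rho>g' \<tau>g'"
    using step_of_abs_step[OF bounded(1) ag rg' injL sL(1,3)] by blast
  note locg = abs_step_locations[OF bounded(1) ag len(1)]
  have g'L: "set \<rho>g' \<subseteq> L" using locg(3) by (auto simp: L_def)
  have wL: "snd ` set w \<subseteq> L" using locg(4) g'L by blast
  obtain es \<tau>f' where pth: "path Tf (fst cf, snd cf) es (qf', \<tau>f')"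
    and es: "map edge_in es = map (apsnd \<theta>') w"
    and rf1: "reads M \<theta>' \<rho>f' \<tau>f'" and f'L: "set \<rho>f' \<subseteq> L" and Qf': "qf' \<in> states Tf"
    and u: "map (apsnd \<theta>') u = concat (map edge_out es)"
    and v: "v = (\<exists>e\<in>set es. fst (edge_src e) \<in> accepting Tf)"
    using path_of_block_run[OF bounded(2) injL br rf' sL(2) wL Q(2)] by auto
  let ?fl' = "if fl then \<not> v else fst cg \<in> accepting Tg"
  have "joint_step Tg Tf j x es ((qg', \<tau>g'), (qf', \<tau>f'), ?fl')"
    using stg pth unfolding joint_step_def j x by (simp add: es v d)
  moreover have "y = concat (map edge_out es)"
    unfolding y u[symmetric] asgn by (simp add: \<theta>'_def apsnd_def map_prod_def)
  moreover have "comp_inv Tg Tf c' ((qg', \<tau>g'), (qf', \<tau>f'), ?fl')"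
  proof -
    have "L \<subseteq> {..<Suc (2 * M)}" using sub p by (auto simp: L_def)
    then have "(qg', qf', ?fl', \<rho>g', \<rho>f') \<in> comp_states (states Tg) (states Tf) M"
      using locg(1,2) Qf' g'L f'L rf1 by (auto simp: comp_states_def reads_def)
    moreover have "inj_on \<theta>' (set \<rho>g' \<union> set \<rho>f')"
      using g'L f'L by (intro inj_on_subset[OF injL]) simp
    ultimately show ?thesis
      unfolding comp_inv_def c' s' asgn \<theta>'_def[symmetric] prod.case fst_conv snd_conv
      using rg1 rf1 by blast
  qed
  ultimately show ?thesis by blast
qed

end

section \<open>Finiteness and well-formedness of the composite\<close>

lemma finite_block_run: "finite (delta T) \<Longrightarrow> finite (block_run T M w c)"
proof (induction w arbitrary: c)
  case (Cons x w)
  have "finite (block_step T M c x)"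
    using Cons.prems by (auto simp: block_step_def split: prod.split)
  with Cons show ?case by simp
qed simp

text \<open>Well-formedness concerns all transitions, also those from unreachable states, so
  locations and letters are tracked here without any valuation.\<close>

lemma block_run_output:
  assumes T: "wf_nrt B C T" "bounded_nrt M T"
  shows "(q', \<rho>', u', v') \<in> block_run T M w (q, \<rho>, u, v) \<Longrightarrow> length \<rho> = M \<Longrightarrow> set \<rho> \<subseteq> L \<Longrightarrow>
    snd ` set w \<subseteq> L \<Longrightarrow> q \<in> states T \<Longrightarrow> set u \<subseteq> C \<times> L \<Longrightarrow>
    q' \<in> states T \<and> length \<rho>' = M \<and> set \<rho>' \<subseteq> L \<and> set u' \<subseteq> C \<times> L"
proof (induction w arbitrary: q \<rho> u v)
  case Nil
  then show ?case by simp
next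
  case (Cons x w)
  obtain b l where x: "x = (b, l)" by (cases x)
  with Cons.prems(1) obtain q1 \<rho>1 y where
    s: "abs_step T M (q, \<rho>) (b, l) y (q1, \<rho>1)" and
    run: "(q', \<rho>', u', v') \<in> block_run T M w (q1, \<rho>1, u @ y, v \<or> q \<in> accepting T)"
    by (auto simp: mem_block_step)
  note loc = abs_step_locations[OF T(2) s Cons.prems(2)]
  have lL: "l \<in> L" "snd ` set w \<subseteq> L" using Cons.prems(4) x by auto
  have L1: "set \<rho>1 \<subseteq> L" using loc(3) Cons.prems(3) lL(1) by blast
  have "fst ` set y \<subseteq> C"
    using s T(1) unfolding abs_step_def wf_nrt_def by fastforce
  moreover have "snd ` set y \<subseteq> L" using loc(4) L1 by blast
  ultimately have "set y \<subseteq> C \<times> L" by (auto simp: mem_Times_iff)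
  then have "set (u @ y) \<subseteq> C \<times> L" using Cons.prems(6) by simp
  from Cons.IH[OF run loc(2) L1 lL(2) loc(1) this] show ?case .
qed

lemma finite_comp_states:
  assumes "finite Qg" "finite Qf" shows "finite (comp_states Qg Qf M)"
  using assms finite_lists_length_eq[of "{..<Suc (2 * M)}" M]
  by (simp add: comp_states_def conj_commute)

section \<open>Infinite runs of the second machine as words of edges\<close>

lemma path_blocks:
  assumes "\<And>n. path T (c n) (E n) (c (Suc n))"
  shows "path T (c 0) (output_upto E n) (c n)"
proof (induction n)
  case (Suc n)
  with assms[of n] show ?case unfolding output_upto_Suc path_append by blast
qed (simp add: output_upto_def)

text \<open>Consecutive edges may lie in different blocks with empty ones between them. They still
  fit together, because every finite prefix of \<open>Y\<close> lies in a concatenation of initial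
  blocks, which is a path.\<close>

lemma run_of_blocks:
  assumes blocks: "\<And>n. path T (c n) (E n) (c (Suc n))" and Y: "spells E Y"
  shows "edge_src (Y 0) = c 0"
    and "step T (edge_src (Y m)) (edge_in (Y m)) (edge_out (Y m)) (edge_src (Y (Suc m)))"
proof -
  have pre: "\<exists>n. path T (c 0) (map Y [0..<length (output_upto E n)]) (c n) \<and>
      m < length (output_upto E n)" for m
  proof -
    obtain n where n: "Suc m \<le> length (output_upto E n)"
      using Y unfolding spells_def infinite_output_def by blast
    have "output_upto E n = map Y [0..<length (output_upto E n)]"
      using Y unfolding spells_def by blast
    with path_blocks[of T c E n, OF blocks] n show ?thesis by (intro exI[of _ n]) simp
  qed
  from pre[of 0] obtain n where "path T (c 0) (map Y [0..<length (output_upto E n)]) (c n)"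
    "0 < length (output_upto E n)" by blast
  from path_hd[OF this(1)] this(2) show "edge_src (Y 0) = c 0" by simp
  from pre[of "Suc m"] obtain n where
    n: "path T (c 0) (map Y [0..<length (output_upto E n)]) (c n)"
    "Suc m < length (output_upto E n)" by blast
  from path_adjacent[OF n(1), of m] n(2) have "edge_src (Y (Suc m)) = edge_tgt (Y m)" by simp
  moreover from path_step[OF n(1), of "Y m"] n(2)
  have "step T (edge_src (Y m)) (edge_in (Y m)) (edge_out (Y m)) (edge_tgt (Y m))" by simp
  ultimately show "step T (edge_src (Y m)) (edge_in (Y m)) (edge_out (Y m)) (edge_src (Y (Suc m)))"
    by simp
qed

lemma path_of_run:
  assumes run: "\<And>m. step T (c m) (y m) (u m) (c (Suc m))" and "k \<le> k'"
  shows "path T (c k) (map (\<lambda>m. (c m, y m, u m, c (Suc m))) [k..<k']) (c k')"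
  using \<open>k \<le> k'\<close>
proof (induction k' rule: dec_induct)
  case (step n)
  have "path T (c n) [(c n, y n, u n, c (Suc n))] (c (Suc n))" using run by simp
  with step show ?case by (simp add: path_append del: path.simps split_paired_Ex) blast
qed simp

context nrt_pair
begin

lemma wf_compose: "wf_nrt A C (compose Tg Tf)"
proof -
  let ?S = "comp_states (states Tg) (states Tf) M"
  have fin: "finite (states Tg)" "finite (states Tf)" "finite (delta Tg)" "finite (delta Tf)"
    and init: "initial Tg \<in> states Tg" "initial Tf \<in> states Tf"
    using wf_Tg wf_Tf by (auto simp: wf_nrt_def)
  have finS: "finite ?S" by (rule finite_comp_states[OF fin(1,2)])
  have "finite (comp_transitions Tg Tf M s p t)" for s p t
    by (cases s; cases t) (simp add: comp_transitions_def finite_block_run[OF fin(4)])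
  then have "finite (delta (compose Tg Tf))"
    using finS fin(3) by (simp add: compose_def Let_def)
  moreover have "initial (compose Tg Tf) \<in> states (compose Tg Tf)"
    unfolding compose_def Let_def using init by (auto simp: comp_states_def)
  moreover have "accepting (compose Tg Tf) \<subseteq> states (compose Tg Tf)"
    unfolding compose_def Let_def by auto
  moreover have "q \<in> states (compose Tg Tf) \<and> a \<in> A \<and> test_regs \<phi> \<subseteq> regs (compose Tg Tf) \<and>
      asgn \<subseteq> regs (compose Tg Tf) \<and> set out \<subseteq> C \<times> regs (compose Tg Tf) \<and> q' \<in> states (compose Tg Tf)"
    if "(q, a, \<phi>, asgn, out, q') \<in> delta (compose Tg Tf)" for q a \<phi> asgn out q'
  proof -
    have "q \<in> enc ` ?S"
      using that unfolding compose_def Let_def comp_transitions_def by (auto split: if_splits)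
    then obtain qg qf fl \<rho>g \<rho>f where q: "q = enc (qg, qf, fl, \<rho>g, \<rho>f)"
      and S: "(qg, qf, fl, \<rho>g, \<rho>f) \<in> ?S" by auto
    from that[unfolded q delta_compose] obtain p w qg' \<rho>g' qf' \<rho>f' v where
      p: "p < Suc (2 * M)" and ag: "abs_step Tg M (qg, \<rho>g) (a, p) w (qg', \<rho>g')"
      and br: "(qf', \<rho>f', out, v) \<in> block_run Tf M w (qf, \<rho>f, [], False)"
      and t: "\<phi> = location_test (\<rho>g @ \<rho>f) p" "asgn = {p}"
        "q' = enc (qg', qf', if fl then \<not> v else qg \<in> accepting Tg, \<rho>g', \<rho>f')"
      by blast
    from S have len: "length \<rho>g = M" "length \<rho>f = M"
      and sub: "set \<rho>g \<subseteq> {..<Suc (2 * M)}" "set \<rho>f \<subseteq> {..<Suc (2 * M)}" and Q: "qf \<in> states Tf"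
      unfolding comp_states_def by auto
    note locg = abs_step_locations[OF bounded(1) ag len(1)]
    have g': "set \<rho>g' \<subseteq> {..<Suc (2 * M)}" using locg(3) sub(1) p by auto
    have w: "snd ` set w \<subseteq> {..<Suc (2 * M)}" using locg(4) g' by blast
    from block_run_output[OF wf_Tf bounded(2) br len(2) sub(2) w Q]
    have f': "qf' \<in> states Tf" "length \<rho>f' = M" "set \<rho>f' \<subseteq> {..<Suc (2 * M)}"
      "set out \<subseteq> C \<times> {..<Suc (2 * M)}" by simp_all
    have "a \<in> A"
      using ag wf_Tg unfolding abs_step_def wf_nrt_def by fastforce
    moreover have "(qg', qf', if fl then \<not> v else qg \<in> accepting Tg, \<rho>g', \<rho>f') \<in> ?S"
      using locg f' g' by (auto simp: comp_states_def)
    moreover have "states (compose Tg Tf) = enc ` ?S" "regs (compose Tg Tf) = {..<Suc (2 * M)}"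
      by (simp_all add: compose_def Let_def)
    ultimately show ?thesis
      using S sub p f'(4) unfolding q t by (simp add: image_iff)
  qed
  moreover have "finite (states (compose Tg Tf))" "finite (regs (compose Tg Tf))"
    using finS by (simp_all add: compose_def Let_def)
  ultimately show ?thesis unfolding wf_nrt_def by blast
qed

text \<open>All registers hold \<open>d0\<close>, so all can share location 0; with at most one
  location in use, injectivity is trivial.\<close>

lemma comp_inv_initial:
  "comp_inv Tg Tf (initial (compose Tg Tf), \<lambda>_. d0) ((initial Tg, \<lambda>_. d0), (initial Tf, \<lambda>_. d0), False)"
proof -
  have "initial Tg \<in> states Tg" "initial Tf \<in> states Tf"
    using wf_Tg wf_Tf by (auto simp: wf_nrt_def)
  then have "(initial Tg, initial Tf, False, replicate M 0, replicate M 0) \<in>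
      comp_states (states Tg) (states Tf) M"
    by (auto simp: comp_states_def)
  moreover have "reads M (\<lambda>_. d0) (replicate M 0) (\<lambda>_. d0)"
    by (simp add: reads_def)
  moreover have "inj_on (\<lambda>_. d0) (set (replicate M 0) \<union> set (replicate M (0 :: nat)))"
    by (auto simp: inj_on_def)
  moreover have "initial (compose Tg Tf) =
      enc (initial Tg, initial Tf, False, replicate M (0::nat), replicate M (0::nat))"
    by (simp add: compose_def Let_def)
  ultimately show ?thesis
    unfolding comp_inv_def prod.case fst_conv snd_conv by blast
qed

lemma accepting_compose:
  assumes "comp_inv Tg Tf c (cg, cf, fl)"
  shows "fst c \<in> accepting (compose Tg Tf) \<longleftrightarrow> \<not> fl \<and> fst cg \<in> accepting Tg"
  using assms unfolding comp_inv_def compose_def Let_def by (auto simp: image_iff)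

definition joint_run ::
    "'d \<Rightarrow> (nat \<Rightarrow> (nat \<times> (nat \<Rightarrow> 'd)) \<times> (nat \<times> (nat \<Rightarrow> 'd)) \<times> bool) \<Rightarrow> (nat \<Rightarrow> 'a \<times> 'd) \<Rightarrow>
     (nat \<Rightarrow> ('b, 'c, 'd) edge list) \<Rightarrow> bool" where
  "joint_run d0 j x E \<longleftrightarrow>
     j 0 = ((initial Tg, \<lambda>_. d0), (initial Tf, \<lambda>_. d0), False) \<and>
     (\<forall>n. joint_step Tg Tf (j n) (x n) (E n) (j (Suc n))) \<and>
     infinite {n. \<not> snd (snd (j n)) \<and> fst (fst (j n)) \<in> accepting Tg}"

lemma joint_run_of_accepting_run:
  assumes run: "accepting_run d0 (compose Tg Tf) x c y"
  shows "\<exists>j E. joint_run d0 j x E \<and> y = (\<lambda>n. concat (map edge_out (E n)))"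
proof -
  let ?j0 = "((initial Tg, \<lambda>_. d0), (initial Tf, \<lambda>_. d0), False)"
  have st: "step (compose Tg Tf) (c n) (x n) (y n) (c (Suc n))" for n
    using run by (simp add: accepting_run_def)
  \<comment> \<open>Each joint configuration depends on the one chosen before, hence dependent
    choice; the clause for \<open>n = 0\<close> pins the start, which the invariant alone would not
    determine.\<close>
  have "\<exists>j. \<forall>n. (comp_inv Tg Tf (c n) (j n) \<and> (n = 0 \<longrightarrow> j n = ?j0)) \<and>
      (\<exists>es. joint_step Tg Tf (j n) (x n) es (j (Suc n)) \<and> y n = concat (map edge_out es))"
  proof (rule dependent_nat_choice)
    show "\<exists>j. comp_inv Tg Tf (c 0) j \<and> (0 = (0::nat) \<longrightarrow> j = ?j0)"
      using comp_inv_initial run unfolding accepting_run_def by (intro exI[of _ ?j0]) simp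
  next
    fix j n assume "comp_inv Tg Tf (c n) j \<and> (n = 0 \<longrightarrow> j = ?j0)"
    then show "\<exists>j'. (comp_inv Tg Tf (c (Suc n)) j' \<and> (Suc n = 0 \<longrightarrow> j' = ?j0)) \<and>
        (\<exists>es. joint_step Tg Tf j (x n) es j' \<and> y n = concat (map edge_out es))"
      using joint_simulates_compose[OF _ st] by blast
  qed
  then obtain j where j: "\<And>n. comp_inv Tg Tf (c n) (j n)" "j 0 = ?j0"
    and "\<And>n. \<exists>es. joint_step Tg Tf (j n) (x n) es (j (Suc n)) \<and> y n = concat (map edge_out es)"
    by blast
  then obtain E where E: "\<And>n. joint_step Tg Tf (j n) (x n) (E n) (j (Suc n))"
    "\<And>n. y n = concat (map edge_out (E n))"
    by metis
  have "fst (c n) \<in> accepting (compose Tg Tf) \<longleftrightarrow>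
      \<not> snd (snd (j n)) \<and> fst (fst (j n)) \<in> accepting Tg" for n
    using accepting_compose[of "c n" "fst (j n)" "fst (snd (j n))" "snd (snd (j n))"] j(1)[of n] by simp
  then have "joint_run d0 j x E"
    using run j(2) E(1) by (simp add: joint_run_def accepting_run_def)
  moreover have "y = (\<lambda>n. concat (map edge_out (E n)))" using E(2) by blast
  ultimately show ?thesis by blast
qed

lemma accepting_run_of_joint_run:
  assumes jr: "joint_run d0 j x E"
  shows "\<exists>c. accepting_run d0 (compose Tg Tf) x c (\<lambda>n. concat (map edge_out (E n)))"
proof -
  let ?c0 = "(initial (compose Tg Tf), \<lambda>_. d0)"
  have j0: "j 0 = ((initial Tg, \<lambda>_. d0), (initial Tf, \<lambda>_. d0), False)"
    and st: "\<And>n. joint_step Tg Tf (j n) (x n) (E n) (j (Suc n))"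
    using jr by (simp_all add: joint_run_def)
  have "\<exists>c. \<forall>n. (comp_inv Tg Tf (c n) (j n) \<and> (n = 0 \<longrightarrow> c n = ?c0)) \<and>
      step (compose Tg Tf) (c n) (x n) (concat (map edge_out (E n))) (c (Suc n))"
  proof (rule dependent_nat_choice)
    show "\<exists>c. comp_inv Tg Tf c (j 0) \<and> (0 = (0::nat) \<longrightarrow> c = ?c0)"
      using comp_inv_initial j0 by auto
  next
    fix c n assume "comp_inv Tg Tf c (j n) \<and> (n = 0 \<longrightarrow> c = ?c0)"
    then show "\<exists>c'. (comp_inv Tg Tf c' (j (Suc n)) \<and> (Suc n = 0 \<longrightarrow> c' = ?c0)) \<and>
        step (compose Tg Tf) c (x n) (concat (map edge_out (E n))) c'"
      using compose_simulates_joint[OF _ st] by blast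
  qed
  then obtain c where c: "\<And>n. comp_inv Tg Tf (c n) (j n)" "c 0 = ?c0"
    "\<And>n. step (compose Tg Tf) (c n) (x n) (concat (map edge_out (E n))) (c (Suc n))"
    by blast
  have "fst (c n) \<in> accepting (compose Tg Tf) \<longleftrightarrow>
      \<not> snd (snd (j n)) \<and> fst (fst (j n)) \<in> accepting Tg" for n
    using accepting_compose[of "c n" "fst (j n)" "fst (snd (j n))" "snd (snd (j n))"] c(1)[of n] by simp
  then show ?thesis
    using jr c(2,3) by (auto simp: joint_run_def accepting_run_def)
qed

text \<open>The letters on the edges are the output of the first machine, so its productivity makes
  the edge word infinite. This word then yields an accepting run of the second machine, and
  productivity of that machine permits regrouping its output.\<close>

lemma accepting_runs_of_joint_run:
  assumes jr: "joint_run d0 j x E" and prod: "productive d0 Tg" "productive d0 Tf"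
  shows "\<exists>w c u y. accepting_run d0 Tg x (\<lambda>n. fst (j n)) w \<and> spells w y \<and>
      accepting_run d0 Tf y c u \<and> infinite_output (\<lambda>n. concat (map edge_out (E n))) \<and>
      (\<forall>z. spells (\<lambda>n. concat (map edge_out (E n))) z \<longleftrightarrow> spells u z)"
proof -
  define fl where "fl n = snd (snd (j n))" for n
  define G where "G n \<longleftrightarrow> fst (fst (j n)) \<in> accepting Tg" for n
  define V where "V n \<longleftrightarrow> (\<exists>e\<in>set (E n). fst (edge_src e) \<in> accepting Tf)" for n
  have st: "joint_step Tg Tf (j n) (x n) (E n) (j (Suc n))" for n
    using jr by (simp add: joint_run_def)
  have js: "step Tg (fst (j n)) (x n) (map edge_in (E n)) (fst (j (Suc n)))"
    "path Tf (fst (snd (j n))) (E n) (fst (snd (j (Suc n))))"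
    "fl (Suc n) = (if fl n then \<not> V n else G n)" for n
    using st[of n] by (auto simp: joint_step_def fl_def G_def V_def case_prod_beta)
  have "\<not> fl 0" using jr by (simp add: joint_run_def fl_def)
  from infinitely_often_flag[of fl V G, OF this js(3)] jr
  have inf: "infinite {n. G n}" "infinite {n. V n}"
    by (simp_all add: joint_run_def fl_def G_def)
  have runG: "accepting_run d0 Tg x (\<lambda>n. fst (j n)) (\<lambda>n. map edge_in (E n))"
    using jr js(1) inf(1) by (simp add: accepting_run_def joint_run_def G_def)
  then have "infinite_output E"
    using prod(1) infinite_output_map[of edge_in E] unfolding productive_def by blast
  then obtain Y where Y: "spells E Y" using spells_exists by blast
  note rb = run_of_blocks[of Tf "\<lambda>n. fst (snd (j n))" E, OF js(2) Y]
  have "infinite {m. fst (edge_src (Y m)) \<in> accepting Tf}"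
    using inf(2) spells_infinitely_often[OF Y, of "\<lambda>e. fst (edge_src e) \<in> accepting Tf"]
    by (simp add: V_def)
  then have runF: "accepting_run d0 Tf (\<lambda>m. edge_in (Y m)) (\<lambda>m. edge_src (Y m)) (\<lambda>m. edge_out (Y m))"
    using rb jr by (simp add: accepting_run_def joint_run_def)
  then have "infinite_output (\<lambda>m. edge_out (Y m))"
    using prod(2) unfolding productive_def by blast
  note rg = spells_regroup[OF Y this]
  from runG runF rg spells_map[OF Y, of edge_in] show ?thesis by blast
qed

lemma joint_run_of_accepting_runs:
  assumes runG: "accepting_run d0 Tg x cg w" and w: "spells w y"
    and runF: "accepting_run d0 Tf y cf u"
  shows "\<exists>j E. joint_run d0 j x E \<and>
      (infinite_output u \<longrightarrow> (\<forall>z. spells (\<lambda>n. concat (map edge_out (E n))) z \<longleftrightarrow> spells u z))"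
proof -
  \<comment> \<open>Number of letters that the first machine has written before step
    \<open>n\<close>, hence the place where block \<open>n\<close> of the second run begins.\<close>
  define k where "k n = length (output_upto w n)" for n
  define Y where "Y m = (cf m, y m, u m, cf (Suc m))" for m
  define E where "E n = map Y [k n..<k (Suc n)]" for n
  have mono: "k n \<le> k (Suc n)" for n by (simp add: k_def output_upto_Suc)
  have out: "output_upto E n = map Y [0..<k n]" for n
  proof (induction n)
    case 0 show ?case by (simp add: output_upto_def k_def)
  next
    case (Suc n)
    have "[0..<k (Suc n)] = [0..<k n] @ [k n..<k (Suc n)]"
      using upt_add_eq_append[of 0 "k n" "k (Suc n) - k n"] mono[of n] by simp
    with Suc show ?case by (simp add: output_upto_Suc E_def)
  qed
  have "infinite_output E"
    using w unfolding spells_def infinite_output_def out by (simp add: k_def)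
  then have Y: "spells E Y" unfolding spells_def out by simp
  have in_E: "map edge_in (E n) = w n" for n
    using spells_block[OF w, of n] by (simp add: E_def Y_def k_def comp_def)
  have path: "path Tf (cf (k n)) (E n) (cf (k (Suc n)))" for n
    unfolding E_def Y_def using runF by (intro path_of_run mono) (simp add: accepting_run_def)
  define V where "V n \<longleftrightarrow> (\<exists>e\<in>set (E n). fst (edge_src e) \<in> accepting Tf)" for n
  \<comment> \<open>The two given runs carry no flag; its course is determined by them.\<close>
  define fl where "fl = rec_nat False (\<lambda>n b. if b then \<not> V n else fst (cg n) \<in> accepting Tg)"
  have fl: "\<not> fl 0" "fl (Suc n) = (if fl n then \<not> V n else fst (cg n) \<in> accepting Tg)" for n
    by (simp_all add: fl_def)
  have "infinite {n. V n}"
    using runF spells_infinitely_often[OF Y, of "\<lambda>e. fst (edge_src e) \<in> accepting Tf"]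
    by (simp add: V_def Y_def accepting_run_def)
  with runG have "infinite {n. \<not> fl n \<and> fst (cg n) \<in> accepting Tg}"
    using infinitely_often_flag[of fl V "\<lambda>n. fst (cg n) \<in> accepting Tg", OF fl]
    by (simp add: accepting_run_def)
  then have "joint_run d0 (\<lambda>n. (cg n, cf (k n), fl n)) x E"
    using runG runF path fl unfolding joint_run_def joint_step_def
    by (simp add: accepting_run_def in_E V_def) (simp add: k_def output_upto_def)
  moreover have "\<forall>z. spells (\<lambda>n. concat (map edge_out (E n))) z \<longleftrightarrow> spells u z"
    if "infinite_output u"
    using spells_regroup(1)[OF Y, of edge_out] that by (simp add: Y_def)
  ultimately show ?thesis by blast
qed

theorem realizes_compose:
  assumes g: "realizes d0 A B Tg g" and f: "realizes d0 B C Tf f"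
  shows "realizes d0 A C (compose Tg Tf) (f \<circ>\<^sub>m g)"
proof -
  have prod: "productive d0 Tg" "productive d0 Tf"
    and semg: "(x, y) \<in> semantics d0 Tg \<longleftrightarrow> g x = Some y"
    and semf: "(y, z) \<in> semantics d0 Tf \<longleftrightarrow> f y = Some z" for x y z
    using g f by (simp_all add: realizes_def)
  have "productive d0 (compose Tg Tf)"
    unfolding productive_def
  proof (intro allI impI)
    fix x c y assume "accepting_run d0 (compose Tg Tf) x c y"
    from joint_run_of_accepting_run[OF this] show "infinite_output y"
      using accepting_runs_of_joint_run[OF _ prod] by blast
  qed
  moreover have "(x, z) \<in> semantics d0 (compose Tg Tf) \<longleftrightarrow> (f \<circ>\<^sub>m g) x = Some z" for x z
  proof
    assume "(x, z) \<in> semantics d0 (compose Tg Tf)"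
    then obtain c u where "accepting_run d0 (compose Tg Tf) x c u" "spells u z"
      by (auto simp: semantics_def)
    with joint_run_of_accepting_run[of d0 x c u]
    obtain j E where "joint_run d0 j x E" "spells (\<lambda>n. concat (map edge_out (E n))) z"
      by blast
    then obtain w cf uf y where "accepting_run d0 Tg x (\<lambda>n. fst (j n)) w" "spells w y"
      "accepting_run d0 Tf y cf uf" "spells uf z"
      using accepting_runs_of_joint_run[OF _ prod] by blast
    then have "(x, y) \<in> semantics d0 Tg" "(y, z) \<in> semantics d0 Tf"
      by (auto simp: semantics_def)
    then show "(f \<circ>\<^sub>m g) x = Some z" using semg semf by (simp add: map_comp_def)
  next
    assume "(f \<circ>\<^sub>m g) x = Some z"
    then obtain y where "g x = Some y" "f y = Some z"
      by (auto simp: map_comp_Some_iff)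
    then obtain cg w cf u where runs: "accepting_run d0 Tg x cg w" "spells w y"
      "accepting_run d0 Tf y cf u" and uz: "spells u z"
      using semg semf unfolding semantics_def by blast
    from uz have "infinite_output u" by (simp add: spells_def)
    with joint_run_of_accepting_runs[OF runs] uz obtain j E where "joint_run d0 j x E"
      "spells (\<lambda>n. concat (map edge_out (E n))) z" by blast
    with accepting_run_of_joint_run[of d0 j x E] show "(x, z) \<in> semantics d0 (compose Tg Tf)"
      by (auto simp: semantics_def)
  qed
  then have "semantics d0 (compose Tg Tf) = {(x, z). (f \<circ>\<^sub>m g) x = Some z}" by auto
  ultimately show ?thesis using wf_compose by (simp add: realizes_def)
qed

end

section \<open>Computing the code of the composed transducer\<close>

text \<open>Decoding is the identity on codes: the list \<open>list_decode n\<close> has code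
  \<open>n\<close>. The next rule holds for the same reason.\<close>

lemma effective_list_decode [eff]: "effective f \<Longrightarrow> effective (\<lambda>x. list_decode (f x))"
  unfolding effective_def by (simp add: enc_list_def map_idI)

lemma effective_prod_decode [eff]: "effective f \<Longrightarrow> effective (\<lambda>x. prod_decode (f x))"
  unfolding effective_def by (simp add: enc_prod_def)

lemma enc_nat_list: "enc l = list_encode l"
  by (simp add: enc_list_def map_idI)

lemma effective_set_encode [eff]: "effective l \<Longrightarrow> effective (\<lambda>x. set_encode (set (l x)))"
proof -
  \<comment> \<open>The membership check keeps a repeated element from contributing its power of two
    twice.\<close>
  have eq: "set_encode (set xs) =
      foldr (\<lambda>y s. if y \<in> set_decode s then s else 2 ^ y + s) xs 0" for xs
  proof (induction xs)
    case (Cons y ys)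
    then show ?case
      by (simp flip: Cons.IH add: insert_absorb)
  qed simp
  show "effective l \<Longrightarrow> effective (\<lambda>x. set_encode (set (l x)))"
    unfolding eq by (intro eff)
qed

lemma effective_product [eff]:
  assumes "effective k" "effective l" shows "effective (\<lambda>x. List.product (k x) (l x))"
proof -
  have eq: "List.product xs ys = concat (map (\<lambda>x. map (\<lambda>y. (x, y)) ys) xs)"
    for xs :: "'b list" and ys :: "'c list"
    by (induction xs) simp_all
  show ?thesis unfolding eq using assms(1) by (intro eff effective_comp[OF assms(2)])
qed

section \<open>Decoding of sets and evaluation of tests on codes\<close>

definition elems :: "nat \<Rightarrow> nat list" where
  "elems s = filter (\<lambda>i. i \<in> set_decode s) [0..<s]"

lemma effective_elems [eff]: "effective f \<Longrightarrow> effective (\<lambda>x. elems (f x))"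
proof -
  assume f: "effective f"
  then show ?thesis unfolding elems_def by (intro eff effective_comp[OF f])
qed

lemma less_of_mem_set_decode: "i \<in> set_decode s \<Longrightarrow> i < s"
proof -
  assume "i \<in> set_decode s"
  then have "s div 2 ^ i \<noteq> 0" by (auto simp: set_decode_def intro: ccontr)
  then have "2 ^ i \<le> s" by (simp add: div_eq_0_iff)
  with less_exp show ?thesis by (rule less_le_trans)
qed

lemma set_elems [simp]: "set (elems s) = set_decode s"
  by (auto simp: elems_def less_of_mem_set_decode)

text \<open>
  Tests are evaluated on their codes by course-of-values recursion: \<open>tbl\<close> lists the smaller codes
  of satisfied tests.
\<close>

definition true_code :: "nat list \<Rightarrow> nat \<Rightarrow> nat list \<Rightarrow> nat \<Rightarrow> bool" where
  "true_code \<rho> l tbl k \<longleftrightarrow>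
     fst (prod_decode k) = 0 \<or>
     fst (prod_decode k) = 2 \<and> val \<rho> (snd (prod_decode k)) = l \<or>
     fst (prod_decode k) = 3 \<and> val \<rho> (snd (prod_decode k)) \<noteq> l \<or>
     fst (prod_decode k) = 4 \<and> snd (prod_decode k) \<notin> set tbl \<or>
     fst (prod_decode k) = 5 \<and> fst (prod_decode (snd (prod_decode k))) \<in> set tbl \<and>
       snd (prod_decode (snd (prod_decode k))) \<in> set tbl \<or>
     fst (prod_decode k) = 6 \<and> (fst (prod_decode (snd (prod_decode k))) \<in> set tbl \<or>
       snd (prod_decode (snd (prod_decode k))) \<in> set tbl)"

definition true_codes :: "nat list \<Rightarrow> nat \<Rightarrow> nat \<Rightarrow> nat list" where
  "true_codes \<rho> l n = rec_nat [] (\<lambda>k tbl. if true_code \<rho> l tbl k then k # tbl else tbl) n"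

definition sat_code :: "nat list \<Rightarrow> nat \<Rightarrow> nat \<Rightarrow> bool" where
  "sat_code \<rho> l c \<longleftrightarrow> c \<in> set (true_codes \<rho> l (Suc c))"

text \<open>The connectives carry the positive tags 4, 5 and 6, so arguments have smaller codes than
  the whole test and the recursion on codes is well founded.\<close>

lemma less_prod_encode: "0 < a \<Longrightarrow> b < prod_encode (a, b)"
proof -
  have "n \<le> triangle n" for n by (induction n) simp_all
  from this[of "a + b"] show "0 < a \<Longrightarrow> b < prod_encode (a, b)" by (simp add: prod_encode_def)
qed

lemma true_codes_bound: "k \<in> set (true_codes \<rho> l n) \<Longrightarrow> k < n"
  by (induction n) (auto simp: true_codes_def split: if_splits)

text \<open>Absence from the table counts as falsity in the case of \<open>Neg\<close>, which is
  sound because the smaller code of the argument has been processed already. Numbers that code no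
  test may enter the table, but no test refers to them.\<close>

lemma mem_true_codes:
  "encode_test \<phi> \<in> set (true_codes \<rho> l n) \<longleftrightarrow> encode_test \<phi> < n \<and> sat (val \<rho>) l \<phi>"
proof (induction n arbitrary: \<phi>)
  case 0
  then show ?case using true_codes_bound by blast
next
  case (Suc n)
  have Suc_eq: "true_codes \<rho> l (Suc n) =
      (if true_code \<rho> l (true_codes \<rho> l n) n then n # true_codes \<rho> l n else true_codes \<rho> l n)"
    by (simp add: true_codes_def)
  show ?case
  proof (cases "encode_test \<phi> = n")
    case False
    then show ?thesis unfolding Suc_eq using Suc.IH[of \<phi>] by auto
  next
    case True
    have "n \<notin> set (true_codes \<rho> l n)" using true_codes_bound by blast
    then have "encode_test \<phi> \<in> set (true_codes \<rho> l (Suc n)) \<longleftrightarrow>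
        true_code \<rho> l (true_codes \<rho> l n) (encode_test \<phi>)"
      unfolding Suc_eq True by simp
    also have "\<dots> \<longleftrightarrow> sat (val \<rho>) l \<phi>"
    proof (cases \<phi>)
      case (Neg \<psi>)
      then have "encode_test \<psi> < n" using True less_prod_encode by auto
      then show ?thesis by (simp add: Neg true_code_def Suc.IH)
    next
      case (Conj \<psi> \<chi>)
      then have "prod_encode (encode_test \<psi>, encode_test \<chi>) < n"
        using True less_prod_encode by auto
      then have "encode_test \<psi> < n" "encode_test \<chi> < n"
        using le_prod_encode_1 le_prod_encode_2 le_less_trans by blast+
      then show ?thesis by (simp add: Conj true_code_def Suc.IH)
    next
      case (Disj \<psi> \<chi>)
      then have "prod_encode (encode_test \<psi>, encode_test \<chi>) < n"
        using True less_prod_encode by auto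
      then have "encode_test \<psi> < n" "encode_test \<chi> < n"
        using le_prod_encode_1 le_prod_encode_2 le_less_trans by blast+
      then show ?thesis by (simp add: Disj true_code_def Suc.IH)
    qed (simp_all add: true_code_def)
    finally show ?thesis using True by simp
  qed
qed

lemma sat_code [simp]: "sat_code \<rho> l (encode_test \<phi>) \<longleftrightarrow> sat (val \<rho>) l \<phi>"
  by (simp add: sat_code_def mem_true_codes)

lemma effective_sat_code [eff]:
  assumes "effective \<rho>" "effective l" "effective c"
  shows "effective (\<lambda>x. sat_code (\<rho> x) (l x) (c x))"
  unfolding sat_code_def true_codes_def true_code_def
  by (intro eff effective_comp[OF assms(1)] effective_comp[OF assms(2)] effective_comp[OF assms(3)])

definition location_test_code :: "nat list \<Rightarrow> nat \<Rightarrow> nat" where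
  "location_test_code us p =
     foldr (\<lambda>u c. prod_encode (5, prod_encode (prod_encode (if u = p then 2 else 3, u), c)))
       us (prod_encode (0, 0))"

lemma encode_location_test [simp]: "encode_test (location_test us p) = location_test_code us p"
  by (induction us) (simp_all add: location_test_code_def)

lemma effective_prod_encode [eff]:
  "effective f \<Longrightarrow> effective g \<Longrightarrow> effective (\<lambda>x. prod_encode (f x, g x))"
  using effective_enc[OF effective_Pair, of f g] by (simp add: enc_prod_def)

lemma effective_location_test_code [eff]:
  assumes "effective us" "effective p"
  shows "effective (\<lambda>x. location_test_code (us x) (p x))"
  unfolding location_test_code_def
  by (intro eff effective_comp[OF assms(1)] effective_comp[OF assms(2)])

lemma effective_upd [eff]:
  assumes "effective M" "effective \<rho>" "effective S" "effective l"
  shows "effective (\<lambda>x. upd (M x) (\<rho> x) (set_decode (S x)) (l x))"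
  unfolding upd_def
  by (intro eff assms(1) effective_comp[OF assms(2)] effective_comp[OF assms(3)] effective_comp[OF assms(4)])

text \<open>
  From here on a transition is the list of its six coded components, so that \<open>val t i\<close> is
  component \<open>i\<close>; sets are given by their codes.
\<close>

definition out_of :: "nat list \<Rightarrow> (nat \<times> nat) list" where
  "out_of t = map prod_decode (list_decode (val t 4))"

definition transitions_of :: "nat \<Rightarrow> nat list list" where
  "transitions_of D = map list_decode (elems D)"

definition relocate :: "nat list \<Rightarrow> (nat \<times> nat) list \<Rightarrow> (nat \<times> nat) list" where
  "relocate \<rho> u = map (\<lambda>x. (fst x, val \<rho> (snd x))) u"

definition block_step_code ::
    "nat \<Rightarrow> nat \<Rightarrow> nat \<Rightarrow> nat block_config \<Rightarrow> nat \<times> nat \<Rightarrow> nat block_config list" where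
  "block_step_code D F M c x =
     map (\<lambda>t. (val t 5, upd M (fst (snd c)) (set_decode (val t 3)) (snd x),
               fst (snd (snd c)) @
                 relocate (upd M (fst (snd c)) (set_decode (val t 3)) (snd x)) (out_of t),
               snd (snd (snd c)) \<or> fst c \<in> set_decode F))
       (filter (\<lambda>t. val t 0 = fst c \<and> val t 1 = fst x \<and> sat_code (fst (snd c)) (snd x) (val t 2))
         (transitions_of D))"

text \<open>Carries the list of all configurations along the block. This turns the branching
  recursion of \<open>block_run\<close> into a \<open>foldl\<close>, which the closure rules
  cover.\<close>

definition block_run_code ::
    "nat \<Rightarrow> nat \<Rightarrow> nat \<Rightarrow> (nat \<times> nat) list \<Rightarrow> nat block_config list \<Rightarrow> nat block_config list" where
  "block_run_code D F M w cs =
     foldl (\<lambda>cs x. concat (map (\<lambda>c. block_step_code D F M c x) cs)) cs w"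

text \<open>\<open>2 ^ p\<close> is the code of the assigned set \<open>{p}\<close>.\<close>

definition comp_transitions_code ::
    "nat \<Rightarrow> nat \<Rightarrow> nat \<Rightarrow> nat \<Rightarrow> comp_state \<Rightarrow> nat \<Rightarrow> nat list \<Rightarrow> nat list" where
  "comp_transitions_code Fg Df Ff M s p t =
     (if val t 0 = fst s \<and> sat_code (fst (snd (snd (snd s)))) p (val t 2) then
        map (\<lambda>c. enc [enc s, val t 1,
               location_test_code (fst (snd (snd (snd s))) @ snd (snd (snd (snd s)))) p, 2 ^ p,
               enc (fst (snd (snd c))),
               enc (val t 5, fst c,
                    if fst (snd (snd s)) then \<not> snd (snd (snd c)) else fst s \<in> set_decode Fg,
                    upd M (fst (snd (snd (snd s)))) (set_decode (val t 3)) p, fst (snd c))])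
          (block_run_code Df Ff M
             (relocate (upd M (fst (snd (snd (snd s)))) (set_decode (val t 3)) p) (out_of t))
             [(fst (snd s), snd (snd (snd (snd s))), [], False)])
      else [])"

definition comp_states_code :: "nat \<Rightarrow> nat \<Rightarrow> nat \<Rightarrow> comp_state list" where
  "comp_states_code Qg Qf M =
     List.product (elems Qg) (List.product (elems Qf) (List.product [False, True]
       (List.product (List.n_lists M [0..<Suc (M + M)]) (List.n_lists M [0..<Suc (M + M)]))))"

text \<open>Component 1 of a machine is the code of its register set, so the recurring sum is
  \<open>reg_bound\<close>.\<close>

definition compose_code :: "nat list \<times> nat list \<Rightarrow> nat list" where
  "compose_code z =
     [set_encode (set (map enc
        (comp_states_code (val (fst z) 0) (val (snd z) 0) (val (fst z) 1 + val (snd z) 1)))),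
      set_encode (set [0..<Suc ((val (fst z) 1 + val (snd z) 1) + (val (fst z) 1 + val (snd z) 1))]),
      enc (val (fst z) 2, val (snd z) 2, False,
        replicate (val (fst z) 1 + val (snd z) 1) (0 :: nat),
        replicate (val (fst z) 1 + val (snd z) 1) (0 :: nat)),
      set_encode (set (map enc (filter
        (\<lambda>s. \<not> fst (snd (snd s)) \<and> fst s \<in> set_decode (val (fst z) 3))
        (comp_states_code (val (fst z) 0) (val (snd z) 0) (val (fst z) 1 + val (snd z) 1))))),
      set_encode (set (concat (map (\<lambda>s. concat (map (\<lambda>p. concat (map (\<lambda>t.
          comp_transitions_code (val (fst z) 3) (val (snd z) 4) (val (snd z) 3)
            (val (fst z) 1 + val (snd z) 1) s p t)
          (transitions_of (val (fst z) 4))))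
        [0..<Suc ((val (fst z) 1 + val (snd z) 1) + (val (fst z) 1 + val (snd z) 1))]))
        (comp_states_code (val (fst z) 0) (val (snd z) 0) (val (fst z) 1 + val (snd z) 1)))))]"

lemma effective_transitions_of [eff]: "effective f \<Longrightarrow> effective (\<lambda>x. transitions_of (f x))"
  unfolding transitions_of_def by (intro eff)

lemma effective_out_of [eff]: "effective f \<Longrightarrow> effective (\<lambda>x. out_of (f x))"
  unfolding out_of_def by (intro eff)

lemma effective_relocate [eff]:
  assumes "effective \<rho>" "effective u" shows "effective (\<lambda>x. relocate (\<rho> x) (u x))"
  unfolding relocate_def using assms(2) by (intro eff effective_comp[OF assms(1)])

lemma effective_block_step_code [eff]:
  assumes "effective D" "effective F" "effective M" "effective c" "effective x"
  shows "effective (\<lambda>z. block_step_code (D z) (F z) (M z) (c z) (x z))"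
  unfolding block_step_code_def
  by (intro eff assms[THEN effective_comp] assms)

lemma effective_block_run_code [eff]:
  assumes "effective D" "effective F" "effective M" "effective w" "effective cs"
  shows "effective (\<lambda>z. block_run_code (D z) (F z) (M z) (w z) (cs z))"
  unfolding block_run_code_def
  by (intro eff assms[THEN effective_comp] assms)

lemma effective_comp_transitions_code [eff]:
  assumes "effective Fg" "effective Df" "effective Ff" "effective M" "effective s" "effective p" "effective t"
  shows "effective (\<lambda>z. comp_transitions_code (Fg z) (Df z) (Ff z) (M z) (s z) (p z) (t z))"
  unfolding comp_transitions_code_def
  by (intro eff assms[THEN effective_comp] assms)

lemma effective_comp_states_code [eff]:
  assumes "effective Qg" "effective Qf" "effective M"
  shows "effective (\<lambda>z. comp_states_code (Qg z) (Qf z) (M z))"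
  unfolding comp_states_code_def
  by (intro eff assms)

lemma effective_compose_code: "effective compose_code"
  unfolding compose_code_def by (intro eff)

section \<open>Agreement of the list program with the construction\<close>

lemma set_comp_states_code:
  assumes "finite Qg" "finite Qf"
  shows "set (comp_states_code (set_encode Qg) (set_encode Qf) M) = comp_states Qg Qf M"
proof -
  have "{0..<Suc (M + M)} = {..<Suc (2 * M)}" by auto
  moreover have "set [False, True] = UNIV" by auto
  ultimately show ?thesis
    using assms unfolding comp_states_code_def comp_states_def set_product set_n_lists set_upt set_elems
    by simp
qed

definition code_config :: "('c \<Rightarrow> nat) \<Rightarrow> 'c block_config \<Rightarrow> nat block_config" where
  "code_config ec = (\<lambda>(q, \<rho>, u, v). (q, \<rho>, map (apfst ec) u, v))"

lemma list_decode_encode_transition [simp]: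
  "list_decode (encode_transition ea eb (q, a, \<phi>, asgn, out, q')) =
     [q, ea a, encode_test \<phi>, set_encode asgn, enc (map (apfst eb) out), q']"
  by (simp add: enc_list_def enc_prod_def comp_def case_prod_unfold)

declare encode_transition.simps [simp del]

lemma out_of_encode_transition [simp]:
  "out_of [q, a, \<phi>, asgn, enc u, q'] = u"
proof -
  have "map prod_decode (map enc u) = u"
    by (simp add: enc_prod_def comp_def map_idI)
  then show ?thesis by (simp add: out_of_def enc_list_def numeral_eq_Suc)
qed

lemma relocate_apfst:
  "relocate \<rho> (map (apfst e) out) = map (apfst e) (map (\<lambda>(b, r). (b, val \<rho> r)) out)"
  by (auto simp: relocate_def)

lemma set_transitions_of:
  assumes "finite D"
  shows "set (transitions_of (set_encode (encode_transition ea eb ` D))) =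
    (\<lambda>t. list_decode (encode_transition ea eb t)) ` D"
  using assms by (simp add: transitions_of_def image_image)

lemma wf_nrt_finite_accepting: "wf_nrt A B T \<Longrightarrow> finite (accepting T)"
  unfolding wf_nrt_def using finite_subset by blast

lemma wf_nrt_transition:
  assumes "wf_nrt A B T" "(q, a, \<phi>, asgn, out, q') \<in> delta T"
  shows "a \<in> A" "finite asgn" "fst ` set out \<subseteq> B"
proof -
  have "a \<in> A \<and> asgn \<subseteq> regs T \<and> set out \<subseteq> B \<times> regs T \<and> finite (regs T)"
    using assms unfolding wf_nrt_def by fastforce
  then show "a \<in> A" "finite asgn" "fst ` set out \<subseteq> B"
    using finite_subset by auto
qed

text \<open>The one place where letters are compared. Both letters lie in \<open>B\<close>, one by
  assumption and one by well-formedness, so comparing their codes is faithful.\<close>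

lemma set_block_step_code:
  assumes wf: "wf_nrt B C T" and inj: "inj_on eb B" and b: "b \<in> B"
  shows "set (block_step_code (set_encode (encode_transition eb ec ` delta T))
      (set_encode (accepting T)) M (code_config ec c) (eb b, l)) =
    code_config ec ` block_step T M c (b, l)"
proof -
  obtain q \<rho> u v where c: "c = (q, \<rho>, u, v)" by (cases c)
  have fin: "finite (delta T)" "finite (accepting T)"
    using wf wf_nrt_finite_accepting[OF wf] by (simp_all add: wf_nrt_def)
  let ?dec = "\<lambda>t. list_decode (encode_transition eb ec t)"
  let ?P = "\<lambda>t. case t of (q1, b1, \<phi>, _) \<Rightarrow> q1 = q \<and> b1 = b \<and> sat (val \<rho>) l \<phi>"
  have "(val (?dec t) 0 = q \<and> val (?dec t) 1 = eb b \<and> sat_code \<rho> l (val (?dec t) 2)) \<longleftrightarrow> ?P t"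
    if "t \<in> delta T" for t
  proof -
    obtain q1 b1 \<phi> asgn out q' where t: "t = (q1, b1, \<phi>, asgn, out, q')" by (cases t)
    with that have "b1 \<in> B" using wf_nrt_transition(1)[OF wf] by blast
    with inj b have "eb b1 = eb b \<longleftrightarrow> b1 = b" by (simp add: inj_on_eq_iff)
    then show ?thesis by (simp add: t numeral_eq_Suc)
  qed
  then have filt: "{x \<in> ?dec ` delta T. val x 0 = q \<and> val x 1 = eb b \<and> sat_code \<rho> l (val x 2)} =
      ?dec ` {t \<in> delta T. ?P t}" by blast
  note asgn = wf_nrt_transition(2)[OF wf]
  let ?G = "\<lambda>t. (val t 5, upd M \<rho> (set_decode (val t 3)) l,
      map (apfst ec) u @ relocate (upd M \<rho> (set_decode (val t 3)) l) (out_of t), v \<or> q \<in> accepting T)"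
  have "set (block_step_code (set_encode (encode_transition eb ec ` delta T))
      (set_encode (accepting T)) M (code_config ec c) (eb b, l)) =
    (\<lambda>t. ?G (?dec t)) ` {t \<in> delta T. ?P t}"
    unfolding block_step_code_def c code_config_def prod.case fst_conv snd_conv set_map set_filter
      set_transitions_of[OF fin(1)] set_encode_inverse[OF fin(2)] filt image_image ..
  also have "\<dots> = code_config ec ` block_step T M c (b, l)"
    unfolding block_step_def c prod.case image_image
  proof (rule image_cong[OF refl])
    fix t assume t: "t \<in> {t \<in> delta T. ?P t}"
    obtain q1 b1 \<phi> asgn out q' where t': "t = (q1, b1, \<phi>, asgn, out, q')" by (cases t)
    \<comment> \<open>Finiteness is what lets \<open>set_decode\<close> recover the assigned set
      from its code.\<close>
    with t asgn have "finite asgn" by blast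
    then show "?G (?dec t) = code_config ec (case t of (_, _, _, asgn, out, q') \<Rightarrow>
        (q', upd M \<rho> asgn l, u @ map (\<lambda>(c, r). (c, val (upd M \<rho> asgn l) r)) out,
         v \<or> q \<in> accepting T))"
      by (simp add: t' code_config_def relocate_apfst numeral_eq_Suc
          del: map_map list_encode.simps)
  qed
  finally show ?thesis .
qed

text \<open>Stated for a set \<open>S\<close> of start configurations, since after one letter the
  list program continues from several at once.\<close>

lemma set_block_run_code:
  assumes wf: "wf_nrt B C T" and inj: "inj_on eb B"
  shows "fst ` set w \<subseteq> B \<Longrightarrow> set cs = code_config ec ` S \<Longrightarrow>
    set (block_run_code (set_encode (encode_transition eb ec ` delta T))
      (set_encode (accepting T)) M (map (apfst eb) w) cs) =
    code_config ec ` (\<Union>c\<in>S. block_run T M w c)"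
proof (induction w arbitrary: cs S)
  case Nil
  then show ?case by (simp add: block_run_code_def)
next
  case (Cons x w)
  obtain b l where x: "x = (b, l)" by (cases x)
  let ?D = "set_encode (encode_transition eb ec ` delta T)" and ?F = "set_encode (accepting T)"
  let ?cs = "concat (map (\<lambda>c. block_step_code ?D ?F M c (eb b, l)) cs)"
  have "b \<in> B" using Cons.prems x by simp
  from set_block_step_code[OF wf inj this]
  have "set ?cs = code_config ec ` (\<Union>c\<in>S. block_step T M c (b, l))"
    using Cons.prems(2) by auto
  from Cons.IH[OF _ this] Cons.prems(1)
  show ?case by (simp add: block_run_code_def x)
qed

lemma set_comp_transitions_code:
  assumes wfg: "wf_nrt A B Tg" and wff: "wf_nrt B C Tf" and inj: "inj_on eb B" and t: "t \<in> delta Tg"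
  shows "set (comp_transitions_code (set_encode (accepting Tg))
      (set_encode (encode_transition eb ec ` delta Tf)) (set_encode (accepting Tf)) M s p
      (list_decode (encode_transition ea eb t))) =
    encode_transition ea ec ` comp_transitions Tg Tf M s p t"
proof -
  obtain qg qf fl \<rho>g \<rho>f where s: "s = (qg, qf, fl, \<rho>g, \<rho>f)" by (cases s)
  obtain q a \<phi> asgn out q' where t': "t = (q, a, \<phi>, asgn, out, q')" by (cases t)
  note fin = wf_nrt_finite_accepting[OF wfg]
  note asgn = wf_nrt_transition(2)[OF wfg t[unfolded t']]
    and out = wf_nrt_transition(3)[OF wfg t[unfolded t']]
  let ?w = "map (\<lambda>(b, r). (b, val (upd M \<rho>g asgn p) r)) out"
  have "fst ` set ?w \<subseteq> B" using out by (auto simp: image_subset_iff)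
  from set_block_run_code[OF wff inj this, of "[(qf, \<rho>f, [], False)]" ec "{(qf, \<rho>f, [], False)}" M]
  have run: "set (block_run_code (set_encode (encode_transition eb ec ` delta Tf))
      (set_encode (accepting Tf)) M (map (apfst eb) ?w) [(qf, \<rho>f, [], False)]) =
    code_config ec ` block_run Tf M ?w (qf, \<rho>f, [], False)"
    by (simp add: code_config_def)
  let ?\<rho> = "upd M \<rho>g asgn p"
  have enc_t: "enc [enc s, ea a, location_test_code (\<rho>g @ \<rho>f) p, 2 ^ p, enc (fst (snd (snd (code_config ec c)))),
        enc (q', fst (code_config ec c),
          if fl then \<not> snd (snd (snd (code_config ec c))) else qg \<in> accepting Tg, ?\<rho>, fst (snd (code_config ec c)))] =
      encode_transition ea ec (case c of (qf', \<rho>f', u, v) \<Rightarrow>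
        (enc s, a, location_test (\<rho>g @ \<rho>f) p, {p}, u,
         enc (q', qf', if fl then \<not> v else qg \<in> accepting Tg, ?\<rho>, \<rho>f')))" for c
  proof -
    obtain qf' \<rho>f' u v where "c = (qf', \<rho>f', u, v)" by (cases c)
    then show ?thesis
      by (simp add: code_config_def encode_transition.simps enc_nat_list)
        (simp add: enc_list_def enc_prod_def comp_def case_prod_unfold)
  qed
  have eq: "comp_transitions_code (set_encode (accepting Tg))
      (set_encode (encode_transition eb ec ` delta Tf)) (set_encode (accepting Tf)) M s p
      (list_decode (encode_transition ea eb t)) =
    (if q = qg \<and> sat (val \<rho>g) p \<phi> then
       map (\<lambda>c. enc [enc s, ea a, location_test_code (\<rho>g @ \<rho>f) p, 2 ^ p, enc (fst (snd (snd c))),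
          enc (q', fst c, if fl then \<not> snd (snd (snd c)) else qg \<in> accepting Tg, ?\<rho>, fst (snd c))])
         (block_run_code (set_encode (encode_transition eb ec ` delta Tf))
            (set_encode (accepting Tf)) M (map (apfst eb) ?w) [(qf, \<rho>f, [], False)])
     else [])"
    unfolding comp_transitions_code_def
    by (simp add: s t' numeral_eq_Suc relocate_apfst asgn fin del: map_map enc_eq_iff)
  show ?thesis
  proof (cases "q = qg \<and> sat (val \<rho>g) p \<phi>")
    case True
    show ?thesis
      unfolding eq if_P[OF True] set_map run
      unfolding comp_transitions_def s t' prod.case if_P[OF True] image_image
      by (rule image_cong[OF refl]) (rule enc_t[unfolded s])
  next
    case False
    show ?thesis
      unfolding eq if_not_P[OF False]
      unfolding comp_transitions_def s t' prod.case if_not_P[OF False] by simp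
  qed
qed

text \<open>Order and repetitions in the computed lists disappear under \<open>set_encode\<close>,
  so agreement of the underlying sets already gives equality of the numbers.\<close>

lemma encode_compose:
  assumes wfg: "wf_nrt A B Tg" and wff: "wf_nrt B C Tf" and inj: "inj_on eb B"
  shows "encode_nrt ea ec (compose Tg Tf) = enc (compose_code
    (list_decode (encode_nrt ea eb Tg), list_decode (encode_nrt eb ec Tf)))"
proof -
  let ?M = "reg_bound Tg Tf" and ?S = "comp_states (states Tg) (states Tf) (reg_bound Tg Tf)"
  have fin: "finite (states Tg)" "finite (states Tf)" "finite (accepting Tg)" "finite (delta Tg)"
    using wfg wff wf_nrt_finite_accepting[OF wfg] by (simp_all add: wf_nrt_def)
  have M: "set_encode (regs Tg) + set_encode (regs Tf) = ?M" by (simp add: reg_bound_def)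
  have locs: "{0..<Suc (?M + ?M)} = {..<Suc (2 * ?M)}" by auto
  have delta: "encode_transition ea ec ` delta (compose Tg Tf) =
      (\<Union>s\<in>?S. \<Union>p\<in>{..<Suc (2 * ?M)}. \<Union>t\<in>delta Tg.
        set (comp_transitions_code (set_encode (accepting Tg))
          (set_encode (encode_transition eb ec ` delta Tf)) (set_encode (accepting Tf)) ?M s p
          (list_decode (encode_transition ea eb t))))"
    unfolding compose_def Let_def
    by (simp add: image_UN set_comp_transitions_code[OF wfg wff inj] cong: SUP_cong)
  have acc: "enc ` {s \<in> ?S. \<not> fst (snd (snd s)) \<and> fst s \<in> accepting Tg} = accepting (compose Tg Tf)"
    unfolding compose_def Let_def by (auto intro!: image_cong)
  define lg where "lg = list_decode (encode_nrt ea eb Tg)"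
  define lf where "lf = list_decode (encode_nrt eb ec Tf)"
  have lg: "val lg 0 = set_encode (states Tg)" "val lg 1 = set_encode (regs Tg)"
    "val lg 2 = initial Tg" "val lg 3 = set_encode (accepting Tg)"
    "val lg 4 = set_encode (encode_transition ea eb ` delta Tg)"
    by (simp_all add: lg_def encode_nrt_def numeral_eq_Suc del: list_encode.simps)
  have lf: "val lf 0 = set_encode (states Tf)" "val lf 1 = set_encode (regs Tf)"
    "val lf 2 = initial Tf" "val lf 3 = set_encode (accepting Tf)"
    "val lf 4 = set_encode (encode_transition eb ec ` delta Tf)"
    by (simp_all add: lf_def encode_nrt_def numeral_eq_Suc del: list_encode.simps)
  have comp: "states (compose Tg Tf) = enc ` ?S" "regs (compose Tg Tf) = {..<Suc (2 * ?M)}"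
    "initial (compose Tg Tf) =
      enc (initial Tg, initial Tf, False, replicate ?M (0 :: nat), replicate ?M (0 :: nat))"
    by (simp_all add: compose_def Let_def)
  have "compose_code (lg, lf) =
      [set_encode (states (compose Tg Tf)), set_encode (regs (compose Tg Tf)),
       initial (compose Tg Tf), set_encode (accepting (compose Tg Tf)),
       set_encode (encode_transition ea ec ` delta (compose Tg Tf))]"
    unfolding compose_code_def fst_conv snd_conv lg lf M set_map set_filter set_concat set_upt locs
      set_comp_states_code[OF fin(1,2)] set_transitions_of[OF fin(4)] set_encode_inverse[OF fin(3)]
      acc delta comp image_image
    by simp
  then show ?thesis
    unfolding lg_def lf_def enc_nat_list by (simp only: encode_nrt_def)
qed

section \<open>The main theorem\<close>

theorem theorem3:
  fixes d0 :: 'd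
  assumes "countable (UNIV :: 'd set)" and "infinite (UNIV :: 'd set)"
  shows "\<exists>h. computable h \<and>
    (\<forall>(A :: 'a set) (B :: 'b set) (C :: 'c set) ea eb ec Tg Tf g f.
       finite A \<and> finite B \<and> finite C \<and>
       inj_on ea A \<and> inj_on eb B \<and> inj_on ec C \<and>
       realizes d0 A B Tg g \<and> realizes d0 B C Tf f \<longrightarrow>
       (\<exists>T. encode_nrt ea ec T = h (prod_encode (encode_nrt ea eb Tg, encode_nrt eb ec Tf)) \<and>
            realizes d0 A C T (f \<circ>\<^sub>m g)))"
proof -
  \<comment> \<open>\<open>h\<close> is fixed before alphabets, numberings and machines, none of
    which \<open>compose_code\<close> mentions.\<close>
  obtain h where h: "computable h \<and> (\<forall>z. h (enc z) = enc (compose_code z))"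
    using effective_compose_code unfolding effective_def ..
  have "encode_nrt ea ec (compose Tg Tf) = h (prod_encode (encode_nrt ea eb Tg, encode_nrt eb ec Tf)) \<and>
      realizes d0 A C (compose Tg Tf) (f \<circ>\<^sub>m g)"
    if inj: "inj_on eb B" and g: "realizes d0 A B Tg g" and f: "realizes d0 B C Tf f"
    for A :: "'a set" and B :: "'b set" and C :: "'c set" and ea eb ec Tg Tf g f
  proof
    have wf: "wf_nrt A B Tg" "wf_nrt B C Tf" using g f by (simp_all add: realizes_def)
    \<comment> \<open>Every number is the code of a list of naturals, so the argument of
      \<open>h\<close> in the statement is the code of an input of
      \<open>compose_code\<close>.\<close>
    have "enc (list_decode (encode_nrt ea eb Tg), list_decode (encode_nrt eb ec Tf)) =
        prod_encode (encode_nrt ea eb Tg, encode_nrt eb ec Tf)"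
      by (simp only: enc_Pair enc_nat_list list_decode_inverse)
    then show "encode_nrt ea ec (compose Tg Tf) =
        h (prod_encode (encode_nrt ea eb Tg, encode_nrt eb ec Tf))"
      using h encode_compose[OF wf inj, of ea ec] by metis
    interpret nrt_pair A B C Tg Tf by standard (fact wf)+
    show "realizes d0 A C (compose Tg Tf) (f \<circ>\<^sub>m g)" by (rule realizes_compose[OF g f])
  qed
  with h show ?thesis by blast
qed

end
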